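(* Let $n,k$ be integers with $0\leq k\leq n-3$ and let $G\in\mathfrak{H}_{n,k}$, i.e. $G$ is a connected graph on $n$ vertices with exactly $k$ pendant vertices. Then: (i) If $2\leq k\leq n-3$, then $\varepsilon(G)\leq \left\lfloor\dfrac{3n^2-k^2-2nk+2(n+k)}{4}\right\rfloor$, and equality is attained by the trees $T(l,k-l,n-k)$ for any $1\leq l\leq k-1$. (ii) If $k=1$, then $\varepsilon(G)\leq \left\lfloor \dfrac{3n^2-4n-3}{4}\right\rfloor$, and equality holds if and only if $G\cong U_{n,3}^l$. (iii) If $n\geq 7$ and $k=0$, then $\varepsilon(G)\leq \left\lfloor \dfrac{3n^2-6n-8}{4}\right\rfloor$, and equality holds if and only if $G\cong C_{3,3}^n$.
   Context: All graphs are finite, simple, connected and undirected. The eccentricity of a vertex $v$ of $G$ is $e_G(v)=\max\{d_G(v,u): u\in V(G)\}$, and the total eccentricity index is $\varepsilon(G)=\sum_{v\in V(G)}e_G(v)$. A pendant vertex is a vertex of degree one. $\mathfrak{H}_{n,k}$ is the set of all connected graphs of order $n$ with exactly $k$ pendant vertices. $P_d$ is the path on $d$ vertices and $C_g$ the cycle on $g$ vertices. $T(l,m,d)$ is the tree on $l+m+d$ vertices obtained from the path $P_d$ by attaching $l$ pendant vertices at one end vertex and $m$ pendant vertices at the other end vertex. For $3\leq g\leq n-1$, $U_{n,g}^l$ is the unicyclic graph on $n$ vertices obtained by joining one end vertex of the path $P_{n-g}$ to a vertex of $C_g$ by an edge (the superscript $l$ is part of the name, not a variable). For $m_1,m_2\geq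 3$ and $n\geq m_1+m_2-1$, $C_{m_1,m_2}^n$ is the graph on $n$ vertices defined as follows: if $n>m_1+m_2-1$, take a path on $n-(m_1+m_2)+2$ vertices and identify one of its end vertices with a vertex of $C_{m_1}$ and its other end vertex with a vertex of $C_{m_2}$; if $n=m_1+m_2-1$, identify one vertex of $C_{m_1}$ with a vertex of $C_{m_2}$. *)

theory Defs
  imports Graph_Theory.Graph_Theory
begin

text \<open>
  A finite simple undirected graph is a \<^locale>\<open>pair_graph\<close>: a finite, loop-free, symmetric
  digraph whose arcs are pairs of vertices. An undirected edge \<open>uv\<close> is the pair of arcs
  \<open>(u, v)\<close>, \<open>(v, u)\<close>, so the degree of a vertex is its \<^const>\<open>out_degree\<close>.
\<close>

definition graph_dist :: "('a, 'b) pre_digraph \<Rightarrow> 'a \<Rightarrow> 'a \<Rightarrow> nat" where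
  "graph_dist G u v = (LEAST d. \<exists>p. pre_digraph.awalk G u p v \<and> length p = d)"

text \<open>\<^const>\<open>graph_dist\<close> is the shortest-path distance of the library for unit arc weights.\<close>

lemma (in wf_digraph) graph_dist_eq_mu:
  assumes "u \<rightarrow>\<^sup>* v"
  shows "\<mu> (\<lambda>_. 1) u v = ereal (real (graph_dist G u v))"
proof -
  have cost: "awalk_cost (\<lambda>_. 1) p = real (length p)" for p :: "'b list"
    by (induct p) auto
  from assms obtain p0 where p0: "awalk u p0 v"
    by (auto simp: reachable_awalk)
  then have "\<exists>d p. awalk u p v \<and> length p = d" by blast
  from LeastI_ex[OF this] obtain p where p: "awalk u p v" "length p = graph_dist G u v"
    unfolding graph_dist_def by blast
  have "graph_dist G u v \<le> length q" if "awalk u q v" for q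
    unfolding graph_dist_def using that by (intro Least_le) blast
  then have "(INF q\<in>{q. awalk u q v}. ereal (real (length q))) = ereal (real (graph_dist G u v))"
    using p by (intro antisym INF_greatest INF_lower2[of p]) auto
  then show ?thesis by (simp add: \<mu>_def cost)
qed

definition eccentricity :: "('a, 'b) pre_digraph \<Rightarrow> 'a \<Rightarrow> nat" where
  "eccentricity G v = Max {graph_dist G v u | u. u \<in> verts G}"

definition total_eccentricity :: "('a, 'b) pre_digraph \<Rightarrow> nat" where
  "total_eccentricity G = (\<Sum>v\<in>verts G. eccentricity G v)"

definition pendant_verts :: "('a, 'b) pre_digraph \<Rightarrow> 'a set" where
  "pendant_verts G = {v \<in> verts G. out_degree G v = 1}"

definition connected_graphs :: "nat \<Rightarrow> nat \<Rightarrow> 'a pair_pre_digraph set" where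
  "connected_graphs n k =
    {G. pair_graph G \<and> connected G \<and> card (pverts G) = n \<and> card (pendant_verts G) = k}"

text \<open>
  The named graphs live on the vertices \<open>0, \<dots>, n - 1\<close>. Edges are listed in one orientation only
  and then closed under reversal.
\<close>

definition graph_on :: "nat \<Rightarrow> (nat \<times> nat) set \<Rightarrow> nat pair_pre_digraph" where
  "graph_on n E = \<lparr> pverts = {..<n}, parcs = E \<union> E\<inverse> \<rparr>"

text \<open>The path on the \<open>d\<close> consecutive vertices starting at \<open>a\<close>.\<close>

definition path_edges :: "nat \<Rightarrow> nat \<Rightarrow> (nat \<times> nat) set" where
  "path_edges a d = {(a + i, a + i + 1) | i. i + 1 < d}"

text \<open>The cycle through the \<open>g\<close> consecutive vertices starting at \<open>a\<close> (meaningful for \<open>g \<ge> 3\<close>).\<close>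

definition cycle_edges :: "nat \<Rightarrow> nat \<Rightarrow> (nat \<times> nat) set" where
  "cycle_edges a g = {(a + i, a + (i + 1) mod g) | i. i < g}"

text \<open>
  \<open>T(l, m, d)\<close>: the path occupies \<open>0, \<dots>, d - 1\<close>; \<open>l\<close> pendant vertices are attached at \<open>0\<close> and
  \<open>m\<close> at \<open>d - 1\<close>.
\<close>

definition T_graph :: "nat \<Rightarrow> nat \<Rightarrow> nat \<Rightarrow> nat pair_pre_digraph" where
  "T_graph l m d = graph_on (l + m + d)
    (path_edges 0 d \<union> {(0, j) | j. d \<le> j \<and> j < d + l}
      \<union> {(d - 1, j) | j. d + l \<le> j \<and> j < d + l + m})"

text \<open>
  \<open>U\<^sub>n\<^sub>,\<^sub>g\<close>: the cycle occupies \<open>0, \<dots>, g - 1\<close>, the path \<open>g, \<dots>, n - 1\<close>, and \<open>0g\<close> is the edge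
  joining them (\<open>3 \<le> g \<le> n - 1\<close>).
\<close>

definition U_graph :: "nat \<Rightarrow> nat \<Rightarrow> nat pair_pre_digraph" where
  "U_graph n g = graph_on n (cycle_edges 0 g \<union> path_edges g (n - g) \<union> {(0, g)})"

text \<open>
  The two cycles joined by a path: the first cycle occupies \<open>0, \<dots>, m1 - 1\<close>, the second
  \<open>n - m2, \<dots>, n - 1\<close>, and the path, on \<open>n - (m1 + m2) + 2\<close> vertices, runs from \<open>m1 - 1\<close> to
  \<open>n - m2\<close>, both ends being shared with the cycles. If \<open>n = m1 + m2 - 1\<close> these two vertices
  coincide and the path is trivial (\<open>m1, m2 \<ge> 3\<close> and \<open>n \<ge> m1 + m2 - 1\<close>).
\<close>

definition C_graph :: "nat \<Rightarrow> nat \<Rightarrow> nat \<Rightarrow> nat pair_pre_digraph" where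
  "C_graph m1 m2 n = graph_on n
    (cycle_edges 0 m1 \<union> path_edges (m1 - 1) (n + 2 - (m1 + m2)) \<union> cycle_edges (n - m2) m2)"

end

theory Submission
  imports Defs
begin

text \<open>
  Deleting edges does not decrease eccentricities, so the total eccentricity of a graph is at most
  that of any of its spanning trees. In a tree the vertices farthest from a given vertex include
  an end of any diametral path \<open>v\<^sub>0, \<dots>, v\<^sub>D\<close>. Hence \<open>v\<^sub>i\<close> has eccentricity \<open>max i (D - i)\<close>, and
  the remaining \<open>n - D - 1\<close> vertices have eccentricity at most \<open>D\<close>. The sum of these values,
  \<open>extremal_total n D\<close>, is strictly increasing in \<open>D < n\<close>. So everything rests on
  spanning trees of small diameter \<open>D\<close>.

  If \<open>k \<ge> 2\<close>, each pendant vertex is a leaf of every spanning tree, a path contains at most two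
  leaves, and \<open>D \<le> n + 1 - k\<close> (\<open>tree_diameter_pendants\<close>).

  If \<open>k = 1\<close>, a breadth-first tree rooted at the pendant vertex has \<open>D \<le> n - 2\<close>: otherwise it
  is a Hamiltonian path whose far end would be a second pendant vertex (\<open>total_one_pendant\<close>).

  If \<open>k = 0\<close>, there are two possibilities. Either all layers of vertices at equal distance from a
  given vertex, except the first and the last, contain at least two vertices. Then eccentricities
  are at most \<open>n / 2\<close>, and the bound holds strictly for \<open>n \<ge> 7\<close>. Or some layer consists of a
  single vertex, which is a cut vertex (\<open>large_ecc_imp_cut_vertex\<close>). On both sides of it there is
  a set attached to the rest through one vertex but by at least two edges (\<open>end_block_exists\<close>). A
  breadth-first tree rooted at the cut vertex uses all these edges, so that a path in it misses a
  vertex of each set, or all of one of them, and \<open>D \<le> n - 3\<close> (\<open>tree_diameter_two_end_blocks\<close>).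

  If the bound is attained, the graph itself has diameter \<open>D\<close>. For \<open>k = 1\<close> and \<open>k = 0\<close> only one or
  two vertices then lie off a diametral path. Each of them is adjacent to an end of the path and to
  the vertex next to that end: all other adjacencies allowed by the degrees make its
  eccentricity smaller than \<open>D\<close> (\<open>extremal_one_pendant\<close>, \<open>extremal_no_pendants\<close>). That the
  named graphs attain the bounds follows from a labelling of the vertices by \<open>0, \<dots>, D\<close> that
  changes by at most one along each edge (\<open>total_ge_potential\<close>).
\<close>

section \<open>Graphs as metrics\<close>

text \<open>
  A connected graph is represented by its distance function alone: two vertices are adjacent
  iff their distance is 1, and \<open>dist_step\<close> makes the distance the one induced by this
  adjacency. A graph and its spanning trees are then two metrics on the same vertex set.
\<close>

locale graph_metric =
  fixes V :: "'a set" and d :: "'a \<Rightarrow> 'a \<Rightarrow> nat"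
  assumes finite_V: "finite V"
    and V_nonempty: "V \<noteq> {}"
    and dist_zero_iff: "x \<in> V \<Longrightarrow> y \<in> V \<Longrightarrow> d x y = 0 \<longleftrightarrow> x = y"
    and dist_sym: "x \<in> V \<Longrightarrow> y \<in> V \<Longrightarrow> d x y = d y x"
    and dist_tri: "x \<in> V \<Longrightarrow> y \<in> V \<Longrightarrow> z \<in> V \<Longrightarrow> d x z \<le> d x y + d y z"
    and dist_step: "x \<in> V \<Longrightarrow> y \<in> V \<Longrightarrow> d x y = Suc m \<Longrightarrow> \<exists>z\<in>V. d x z = m \<and> d z y = 1"
begin

definition nbrs :: "'a \<Rightarrow> 'a set" where
  "nbrs x = {y \<in> V. d x y = 1}"

definition ecc :: "'a \<Rightarrow> nat" where
  "ecc x = Max (d x ` V)"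

definition total :: nat where
  "total = (\<Sum>x\<in>V. ecc x)"

definition geodesic :: "nat \<Rightarrow> (nat \<Rightarrow> 'a) \<Rightarrow> bool" where
  "geodesic D v \<longleftrightarrow> (\<forall>i\<le>D. v i \<in> V) \<and> (\<forall>i\<le>D. \<forall>j\<le>D. d (v i) (v j) = (i - j) + (j - i))"

lemma dist_self [simp]: "x \<in> V \<Longrightarrow> d x x = 0"
  by (simp add: dist_zero_iff)

lemma finite_nbrs: "finite (nbrs x)"
  using finite_V by (simp add: nbrs_def)

lemma dist_le_ecc: "y \<in> V \<Longrightarrow> d x y \<le> ecc x"
  using finite_V by (simp add: ecc_def)

lemma ecc_le: "(\<And>y. y \<in> V \<Longrightarrow> d x y \<le> m) \<Longrightarrow> ecc x \<le> m"
  using finite_V V_nonempty by (simp add: ecc_def)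

lemma ecc_attained: "\<exists>y\<in>V. d x y = ecc x"
proof -
  have "ecc x \<in> d x ` V"
    unfolding ecc_def using finite_V V_nonempty by (intro Max_in) auto
  then show ?thesis by force
qed

text \<open>
  Every intermediate distance from \<open>x\<close> is attained on the way to \<open>y\<close>, and by distinct vertices.
\<close>

lemma dist_less_card:
  assumes "x \<in> V" "y \<in> V" shows "d x y < card V"
proof -
  have "\<forall>i\<le>m. \<exists>z\<in>V. d x z = i" if "y \<in> V" "d x y = m" for m y
    using that
  proof (induction m arbitrary: y)
    case 0
    then show ?case by auto
  next
    case (Suc m)
    then obtain z where "z \<in> V" "d x z = m"
      using dist_step[OF assms(1)] by blast
    with Suc show ?case by (metis le_Suc_eq)
  qed
  then have "{..d x y} \<subseteq> d x ` V" using assms(2) by (force simp: image_iff)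
  then have "card {..d x y} \<le> card V"
    using finite_V surj_card_le by blast
  then show ?thesis by simp
qed

text \<open>
  The steps give a walk whose length is the distance of its ends; the triangle inequality leaves no
  room for any two of its vertices to be closer than along the walk.
\<close>

lemma geodesic_exists:
  assumes "a \<in> V" "b \<in> V"
  shows "\<exists>v. geodesic (d a b) v \<and> v 0 = a \<and> v (d a b) = b"
proof -
  have "\<exists>v. (\<forall>i\<le>m. v i \<in> V \<and> d a (v i) = i) \<and> (\<forall>i<m. d (v i) (v (Suc i)) = 1) \<and> v 0 = a \<and> v m = b"
    if "b \<in> V" "d a b = m" for m b
    using that
  proof (induction m arbitrary: b)
    case 0
    then show ?case using assms dist_zero_iff by (intro exI[of _ "\<lambda>_. a"]) auto
  next
    case (Suc m)
    then obtain z where z: "z \<in> V" "d a z = m" "d z b = 1"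
      using dist_step[OF assms(1)] by blast
    from Suc.IH[OF z(1,2)] obtain v where
      v: "\<forall>i\<le>m. v i \<in> V \<and> d a (v i) = i" "\<forall>i<m. d (v i) (v (Suc i)) = 1" "v 0 = a" "v m = z"
      by auto
    show ?case
      by (intro exI[of _ "v(Suc m := b)"])
        (use v z Suc.prems in \<open>auto simp: le_Suc_eq less_Suc_eq\<close>)
  qed
  from this[OF assms(2) refl] obtain v where
    v: "\<forall>i\<le>d a b. v i \<in> V \<and> d a (v i) = i" "\<forall>i<d a b. d (v i) (v (Suc i)) = 1"
       "v 0 = a" "v (d a b) = b" by auto
  have up: "d (v i) (v (i + k)) \<le> k" if "i + k \<le> d a b" for i k
    using that
  proof (induction k)
    case 0
    then show ?case using v by auto
  next
    case (Suc k)
    have "d (v i) (v (Suc (i + k))) \<le> d (v i) (v (i + k)) + d (v (i + k)) (v (Suc (i + k)))"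
      using Suc.prems v by (intro dist_tri) auto
    then show ?case using Suc v by auto
  qed
  have eq: "d (v i) (v j) = j - i" if "i \<le> j" "j \<le> d a b" for i j
  proof -
    have "d a (v j) \<le> d a (v i) + d (v i) (v j)"
      using that v assms by (intro dist_tri) auto
    moreover have "d (v i) (v j) \<le> j - i" using up[of i "j - i"] that by auto
    moreover have "d a (v j) = j" "d a (v i) = i" using v that by auto
    ultimately show ?thesis by linarith
  qed
  have "d (v i) (v j) = (i - j) + (j - i)" if "i \<le> d a b" "j \<le> d a b" for i j
  proof (cases "i \<le> j")
    case True then show ?thesis using eq that by auto
  next
    case False
    then have "d (v j) (v i) = i - j" using eq[of j i] that by auto
    then show ?thesis using False dist_sym[of "v i" "v j"] v that by auto
  qed
  then show ?thesis using v unfolding geodesic_def by blast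
qed

lemma geodesic_in: "geodesic D v \<Longrightarrow> i \<le> D \<Longrightarrow> v i \<in> V"
  by (simp add: geodesic_def)

lemma geodesic_dist: "geodesic D v \<Longrightarrow> i \<le> D \<Longrightarrow> j \<le> D \<Longrightarrow> d (v i) (v j) = (i - j) + (j - i)"
  by (simp add: geodesic_def)

lemma geodesic_inj: "geodesic D v \<Longrightarrow> inj_on v {..D}"
  by (rule inj_onI) (use geodesic_dist geodesic_in dist_self in fastforce)

lemma geodesic_eq_iff:
  "geodesic D v \<Longrightarrow> i \<le> D \<Longrightarrow> j \<le> D \<Longrightarrow> v i = v j \<longleftrightarrow> i = j"
  using inj_on_eq_iff[OF geodesic_inj] by auto

lemma geodesic_rev: "geodesic D v \<Longrightarrow> geodesic D (\<lambda>i. v (D - i))"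
  by (auto simp: geodesic_def)

lemma card_geodesic: "geodesic D v \<Longrightarrow> card (v ` {..D}) = Suc D"
  by (simp add: card_image geodesic_inj)

lemma card_off_geodesic:
  assumes "geodesic D v"
  shows "card (V - v ` {..D}) = card V - Suc D" "Suc D \<le> card V"
proof -
  have sub: "v ` {..D} \<subseteq> V" using assms geodesic_in by auto
  then show "card (V - v ` {..D}) = card V - Suc D"
    using card_geodesic[OF assms] by (simp add: card_Diff_subset)
  show "Suc D \<le> card V"
    using card_mono[OF finite_V sub] card_geodesic[OF assms] by simp
qed

lemma nbrs_on_geodesic:
  assumes "geodesic D v" "i \<le> D" "j \<le> D"
  shows "v j \<in> nbrs (v i) \<longleftrightarrow> j = Suc i \<or> i = Suc j"
  using assms by (auto simp: nbrs_def geodesic_in geodesic_dist)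

lemma total_cong_le:
  assumes "\<And>x. x \<in> V \<Longrightarrow> ecc x \<le> m"
  shows "total \<le> card V * m"
  unfolding total_def using sum_bounded_above[of V ecc m] assms by simp

end

section \<open>The bound as a function of the diameter\<close>

text \<open>
  On a path \<open>v\<^sub>0, \<dots>, v\<^sub>D\<close> the eccentricity of \<open>v\<^sub>i\<close> is \<open>max i (D - i)\<close>. The extremal value below
  charges the largest possible eccentricity \<open>D\<close> to each of the \<open>n - D - 1\<close> vertices off a
  diametral path.
\<close>

definition path_total :: "nat \<Rightarrow> nat" where
  "path_total D = (\<Sum>i\<le>D. max i (D - i))"

definition extremal_total :: "nat \<Rightarrow> nat \<Rightarrow> nat" where
  "extremal_total n D = path_total D + (n - Suc D) * D"

text \<open>
  Dropping the two ends of a path removes \<open>2 D\<close> and lowers every other eccentricity by one, which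
  gives a recursion with step two; hence the parity term.
\<close>

lemma path_total_closed:
  "4 * path_total D + (D + 1) mod 2 = (3 * D + 1) * (D + 1)"
proof (induction D rule: nat_less_induct)
  case (1 D)
  consider "D = 0" | "D = 1" | E where "D = Suc (Suc E)"
    by (metis One_nat_def not0_implies_Suc)
  then show ?case
  proof cases
    case 1
    then show ?thesis by (simp add: path_total_def)
  next
    case 2
    then show ?thesis by (simp add: path_total_def)
  next
    case 3
    have "path_total D = (\<Sum>i\<le>E. max (Suc i) (Suc E - i)) + 2 * D"
      unfolding path_total_def 3
      by (subst sum.atMost_Suc_shift) (simp add: sum.atMost_Suc)
    also have "(\<Sum>i\<le>E. max (Suc i) (Suc E - i)) = (\<Sum>i\<le>E. max i (E - i) + 1)"
      by (rule sum.cong) auto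
    also have "\<dots> = path_total E + (E + 1)"
      by (simp only: sum.distrib path_total_def) simp
    finally have "path_total D = path_total E + (E + 1) + 2 * D" .
    moreover have "4 * path_total E + (E + 1) mod 2 = (3 * E + 1) * (E + 1)"
      using 1 3 by auto
    moreover have "(D + 1) mod 2 = (E + 1) mod 2" using 3 by simp
    ultimately have "4 * path_total D + (D + 1) mod 2 = (3 * E + 1) * (E + 1) + 4 * (E + 1) + 8 * D"
      by simp
    also have "\<dots> = (3 * D + 1) * (D + 1)" using 3 by (simp add: algebra_simps)
    finally show ?thesis .
  qed
qed

text \<open>
  Lengthening the path by one vertex gains about \<open>3 D / 2\<close> on the path and loses only \<open>D\<close> for the
  vertex that moves onto it.
\<close>

lemma extremal_total_Suc:
  assumes "Suc D < n" shows "extremal_total n D < extremal_total n (Suc D)"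
proof -
  obtain m where m: "n = m + Suc (Suc D)" using assms less_iff_Suc_add by (metis Suc_leI add.commute le_Suc_ex)
  have "4 * path_total D + (D + 1) mod 2 = (3 * D + 1) * (D + 1)" by (rule path_total_closed)
  moreover have "4 * path_total (Suc D) + (D + 2) mod 2 = (3 * D + 4) * (D + 2)"
    using path_total_closed[of "Suc D"] by (simp add: algebra_simps)
  moreover have "(3 * D + 4) * (D + 2) = (3 * D + 1) * (D + 1) + 6 * D + 7" by (simp add: algebra_simps)
  moreover have "(D + 1) mod 2 + (D + 2) mod 2 = 1" by presburger
  ultimately have "4 * path_total D + 6 * D + 6 \<le> 4 * path_total (Suc D)" by linarith
  then show ?thesis by (simp add: extremal_total_def m)
qed

lemma extremal_total_strict_mono:
  assumes "D < E" "E < n" shows "extremal_total n D < extremal_total n E"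
  using assms
proof (induction E)
  case (Suc E)
  then show ?case
    using extremal_total_Suc[of E n] by (cases "D = E") auto
qed simp

lemma extremal_total_mono:
  assumes "D \<le> E" "E < n" shows "extremal_total n D \<le> extremal_total n E"
  using extremal_total_strict_mono[of D E n] assms by (cases "D = E") auto

text \<open>
  With \<open>D = n + 1 - k\<close>, four times the extremal value differs from the numerator by
  \<open>(D + 1) mod 2\<close>. The numerators for one and for no pendant vertex are the instances
  \<open>k = 3\<close> and \<open>k = 4\<close>: the extremal graphs there have the diameter of a tree with three,
  respectively four, leaves.
\<close>

lemma extremal_total_eq_floor:
  assumes "2 \<le> k" "k \<le> n"
  shows "int (extremal_total n (n + 1 - k))
    = \<lfloor>(3 * real n ^ 2 - real k ^ 2 - 2 * real n * real k + 2 * (real n + real k)) / 4\<rfloor>"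
proof -
  define D where "D = n + 1 - k"
  obtain j where k: "k = j + 2" using assms(1) le_Suc_ex by (metis add.commute)
  have n: "n = D + j + 1" using assms k by (simp add: D_def)
  define r where "r = (D + 1) mod 2"
  have "4 * extremal_total n D + r = (3 * D + 1) * (D + 1) + 4 * j * D"
    using path_total_closed[of D] n by (simp add: extremal_total_def r_def algebra_simps)
  then have "real (4 * extremal_total n D + r) = real ((3 * D + 1) * (D + 1) + 4 * j * D)"
    by (rule arg_cong)
  then have "4 * real (extremal_total n D) + real r
      = (3 * real D + 1) * (real D + 1) + 4 * real j * real D"
    by (simp add: algebra_simps)
  also have "\<dots> = 3 * real n ^ 2 - real k ^ 2 - 2 * real n * real k + 2 * (real n + real k)"
    by (simp add: n k power2_eq_square algebra_simps)
  finally have "4 * real (extremal_total n D) + real r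
      = 3 * real n ^ 2 - real k ^ 2 - 2 * real n * real k + 2 * (real n + real k)" .
  moreover have "r < 2" by (simp add: r_def)
  ultimately show ?thesis unfolding D_def [symmetric]
    by (intro floor_unique [symmetric]) auto
qed

text \<open>
  This is where \<open>n \<ge> 7\<close> enters: the cycle on \<open>n\<close> vertices has no pendant vertex and total
  eccentricity \<open>n * (n div 2)\<close>, and for \<open>n = 6\<close> this exceeds the bound.
\<close>

lemma half_bound_less_extremal:
  assumes "7 \<le> n" shows "n * (n div 2) < extremal_total n (n - 3)"
proof -
  obtain m where m: "n = m + 7" using assms le_Suc_ex by (metis add.commute)
  have "4 * path_total (m + 4) + (m + 5) mod 2 = (3 * m + 13) * (m + 5)"
    using path_total_closed[of "m + 4"] by (simp add: algebra_simps)
  moreover have "extremal_total n (n - 3) = path_total (m + 4) + 2 * (m + 4)"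
    by (simp add: extremal_total_def m add.commute)
  moreover have "(m + 5) mod 2 \<le> 1" by simp
  ultimately have "4 * extremal_total n (n - 3) + 1 \<ge> (3 * m + 13) * (m + 5) + 8 * (m + 4)"
    by linarith
  moreover have "4 * (n * (n div 2)) \<le> 2 * (n * n)"
    by (simp add: mult.assoc [symmetric])
  moreover have "4 * (n * (n div 2)) = 2 * (n * (2 * (n div 2)))" by simp
  moreover have "2 * (n * n) + 1 < (3 * m + 13) * (m + 5) + 8 * (m + 4) \<or> m = 0"
    by (auto simp: m algebra_simps)
  moreover have "m = 0 \<Longrightarrow> ?thesis"
    using path_total_closed[of 4] by (simp add: extremal_total_def m)
  ultimately show ?thesis by linarith
qed

section \<open>Summing eccentricities along a geodesic\<close>

context graph_metric
begin

lemma total_split: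
  assumes "geodesic D v"
  shows "total = (\<Sum>i\<le>D. ecc (v i)) + (\<Sum>x\<in>V - v ` {..D}. ecc x)"
proof -
  have "v ` {..D} \<subseteq> V" using assms geodesic_in by auto
  then have "total = (\<Sum>x\<in>V - v ` {..D}. ecc x) + (\<Sum>x\<in>v ` {..D}. ecc x)"
    unfolding total_def using finite_V by (rule sum.subset_diff)
  then show ?thesis
    using geodesic_inj[OF assms] by (simp add: sum.reindex)
qed

lemma total_le_geodesic:
  assumes "geodesic D v"
    and on: "\<And>i. i \<le> D \<Longrightarrow> ecc (v i) \<le> max i (D - i)"
    and off: "\<And>x. x \<in> V - v ` {..D} \<Longrightarrow> ecc x \<le> D"
  shows "total \<le> extremal_total (card V) D"
    and "\<exists>x\<in>V - v ` {..D}. ecc x < D \<Longrightarrow> total < extremal_total (card V) D"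
proof -
  have on': "(\<Sum>i\<le>D. ecc (v i)) \<le> path_total D"
    unfolding path_total_def using on by (intro sum_mono) auto
  have c: "(\<Sum>x\<in>V - v ` {..D}. D) = (card V - Suc D) * D"
    using card_off_geodesic[OF assms(1)] by simp
  have "(\<Sum>x\<in>V - v ` {..D}. ecc x) \<le> (card V - Suc D) * D"
    unfolding c [symmetric] using off by (rule sum_mono)
  with on' show "total \<le> extremal_total (card V) D"
    by (simp add: total_split[OF assms(1)] extremal_total_def)
  assume "\<exists>x\<in>V - v ` {..D}. ecc x < D"
  then have "(\<Sum>x\<in>V - v ` {..D}. ecc x) < (card V - Suc D) * D"
    unfolding c [symmetric] using off finite_V by (intro sum_strict_mono_ex1) auto
  with on' show "total < extremal_total (card V) D"
    by (simp add: total_split[OF assms(1)] extremal_total_def)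
qed

text \<open>
  A labelling that changes by at most one along each edge bounds distances from below, so
  \<open>ecc x\<close> is at least the distance of \<open>f x\<close> to either end of \<open>{0..D}\<close>. This replaces
  the computation of distances in concrete graphs.
\<close>

lemma total_ge_potential:
  assumes lip: "\<And>x y. x \<in> V \<Longrightarrow> y \<in> V \<Longrightarrow> d x y = 1 \<Longrightarrow> f y \<le> Suc (f x)"
    and v: "\<And>i. i \<le> D \<Longrightarrow> v i \<in> V \<and> f (v i) = i"
    and off: "\<And>x. x \<in> V - v ` {..D} \<Longrightarrow> f x = 0 \<or> f x = D"
  shows "extremal_total (card V) D \<le> total"
proof -
  have lip': "f y \<le> f x + m" if "x \<in> V" "y \<in> V" "d x y = m" for x y m
    using that
  proof (induction m arbitrary: y)
    case 0
    then show ?case using dist_zero_iff by auto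
  next
    case (Suc m)
    then obtain z where z: "z \<in> V" "d x z = m" "d z y = 1"
      using dist_step[of x y m] by auto
    have "f z \<le> f x + m" using Suc.IH Suc.prems z by auto
    moreover have "f y \<le> Suc (f z)" using lip z Suc.prems by auto
    ultimately show ?case by simp
  qed
  have ecc_ge: "max (f x) (D - f x) \<le> ecc x" if "x \<in> V" for x
  proof -
    have "f x \<le> f (v 0) + d (v 0) x" "f (v D) \<le> f x + d x (v D)"
      using lip'[of "v 0" x] lip'[of x "v D"] that v by blast+
    moreover have "d (v 0) x = d x (v 0)" using dist_sym that v by auto
    moreover have "d x (v 0) \<le> ecc x" "d x (v D) \<le> ecc x"
      using dist_le_ecc v by auto
    moreover have "f (v 0) = 0" "f (v D) = D" using v by auto
    ultimately show ?thesis by linarith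
  qed
  have sub: "v ` {..D} \<subseteq> V" using v by auto
  have inj: "inj_on v {..D}" using v by (metis atMost_iff inj_onI)
  have "card (V - v ` {..D}) = card V - Suc D"
    using sub inj by (simp add: card_Diff_subset card_image)
  then have "(card V - Suc D) * D = (\<Sum>x\<in>V - v ` {..D}. D)" by simp
  also have "\<dots> \<le> (\<Sum>x\<in>V - v ` {..D}. ecc x)"
    using off ecc_ge by (intro sum_mono) force
  finally have 1: "(card V - Suc D) * D \<le> (\<Sum>x\<in>V - v ` {..D}. ecc x)" .
  have "path_total D \<le> (\<Sum>i\<le>D. ecc (v i))"
    unfolding path_total_def using ecc_ge v by (intro sum_mono) (metis atMost_iff)
  also have "\<dots> = (\<Sum>x\<in>v ` {..D}. ecc x)" using inj by (simp add: sum.reindex)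
  finally have 2: "path_total D \<le> (\<Sum>x\<in>v ` {..D}. ecc x)" .
  have "total = (\<Sum>x\<in>V - v ` {..D}. ecc x) + (\<Sum>x\<in>v ` {..D}. ecc x)"
    unfolding total_def using sub finite_V by (rule sum.subset_diff)
  with 1 2 show ?thesis by (simp add: extremal_total_def)
qed

end

section \<open>Tree metrics\<close>

text \<open>
  Trees enter only through the four-point condition: of the three ways to pair up four vertices,
  the two largest distance sums agree. In this form, being a tree is easily seen to be preserved when a
  leaf is added.
\<close>

locale tree_metric = graph_metric V t for V :: "'a set" and t +
  assumes four_point: "x \<in> V \<Longrightarrow> y \<in> V \<Longrightarrow> z \<in> V \<Longrightarrow> w \<in> V \<Longrightarrow>
    t x y + t z w \<le> t x z + t y w \<or> t x y + t z w \<le> t x w + t y z"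
begin

text \<open>
  In a tree a farthest vertex can always be found among the ends \<open>a\<close>, \<open>b\<close> of a diametral path:
  apply the four-point condition to \<open>v\<^sub>i\<close>, \<open>y\<close>, \<open>a\<close>, \<open>b\<close> and use that no distance exceeds that of
  \<open>a\<close> and \<open>b\<close>.
\<close>

lemma total_le_diameter:
  assumes "a \<in> V" "b \<in> V" and diam: "\<And>x y. x \<in> V \<Longrightarrow> y \<in> V \<Longrightarrow> t x y \<le> t a b"
  shows "total \<le> extremal_total (card V) (t a b)"
proof -
  obtain v where v: "geodesic (t a b) v" "v 0 = a" "v (t a b) = b"
    using geodesic_exists assms by blast
  show ?thesis
  proof (rule total_le_geodesic(1)[OF v(1)])
    fix x assume "x \<in> V - v ` {..t a b}"
    then show "ecc x \<le> t a b" using diam by (intro ecc_le) auto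
  next
    fix i assume i: "i \<le> t a b"
    have vi: "v i \<in> V" "t (v i) a = i" "t (v i) b = t a b - i"
      using geodesic_in[OF v(1) i] geodesic_dist[OF v(1) i, of 0]
        geodesic_dist[OF v(1) i, of "t a b"] v(2,3) i by auto
    show "ecc (v i) \<le> max i (t a b - i)"
    proof (rule ecc_le)
      fix y assume y: "y \<in> V"
      have "t (v i) y + t a b \<le> t (v i) a + t y b \<or> t (v i) y + t a b \<le> t (v i) b + t y a"
        using four_point vi y assms by blast
      moreover have "t y a \<le> t a b" "t y b \<le> t a b" using diam y assms by auto
      ultimately show "t (v i) y \<le> max i (t a b - i)" using vi by linarith
    qed
  qed
qed

end

lemma tree_metric_singleton: "tree_metric {r} (\<lambda>_ _. 0)"
  by unfold_locales auto

text \<open>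
  The new leaf \<open>w\<close> is attached to \<open>u\<close>. Replacing \<open>w\<close> by \<open>u\<close> lowers all three sums of the
  four-point condition by the same amount as long as \<open>w\<close> occurs once among the four points; if it
  occurs more often the condition is a triangle inequality.
\<close>

lemma tree_metric_add_leaf:
  assumes "tree_metric S t" and u: "u \<in> S" and w: "w \<notin> S"
  shows "tree_metric (insert w S)
    (\<lambda>x y. if x = w then (if y = w then 0 else Suc (t u y))
           else if y = w then Suc (t x u) else t x y)"
    (is "tree_metric _ ?t")
proof -
  interpret tree_metric S t by fact
  have ne: "x \<noteq> w" if "x \<in> S" for x using that w by auto
  show ?thesis
  proof
    show "finite (insert w S)" "insert w S \<noteq> {}" using finite_V by auto
  next
    fix x y assume "x \<in> insert w S" "y \<in> insert w S"
    then show "?t x y = 0 \<longleftrightarrow> x = y" using dist_zero_iff by auto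
    show "?t x y = ?t y x"
      using \<open>x \<in> insert w S\<close> \<open>y \<in> insert w S\<close> u dist_sym by auto
  next
    fix x y z assume "x \<in> insert w S" "y \<in> insert w S" "z \<in> insert w S"
    then show "?t x z \<le> ?t x y + ?t y z"
      using u dist_tri[of x y z] dist_tri[of u y z] dist_tri[of x y u] dist_tri[of x u z]
        dist_sym[of u y] by (auto split: if_splits)
  next
    fix x y m assume xy: "x \<in> insert w S" "y \<in> insert w S" and m: "?t x y = Suc m"
    consider "x = w" "y \<in> S" | "x \<in> S" "y = w" | "x \<in> S" "y \<in> S"
      using xy m by (auto split: if_splits)
    then show "\<exists>z\<in>insert w S. ?t x z = m \<and> ?t z y = 1"
    proof cases
      case 1
      then have tm: "t u y = m" using m ne[of y] by auto
      show ?thesis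
      proof (cases m)
        case 0
        then have "u = y" using tm dist_zero_iff u 1 by auto
        then show ?thesis using 0 1 ne[of y] by (intro bexI[of _ w]) auto
      next
        case (Suc k)
        then obtain z where "z \<in> S" "t u z = k" "t z y = 1"
          using dist_step[OF u 1(2)] tm by auto
        then show ?thesis using Suc 1 ne by (intro bexI[of _ z]) auto
      qed
    next
      case 2
      then show ?thesis using m u ne[of u] ne[of x] by (intro bexI[of _ u]) auto
    next
      case 3
      then obtain z where "z \<in> S" "t x z = m" "t z y = 1"
        using dist_step[OF 3] m ne by auto
      then show ?thesis using 3 ne by (intro bexI[of _ z]) auto
    qed
  next
    fix x y z q assume *: "x \<in> insert w S" "y \<in> insert w S" "z \<in> insert w S" "q \<in> insert w S"
    \<comment> \<open>the retraction that replaces the leaf by its neighbour\<close>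
    define p where "p = (\<lambda>x. if x = w then u else x)"
    have p: "p x \<in> S" "p y \<in> S" "p z \<in> S" "p q \<in> S" using * u by (auto simp: p_def)
    have fp: "t (p x) (p y) + t (p z) (p q) \<le> t (p x) (p z) + t (p y) (p q) \<or>
        t (p x) (p y) + t (p z) (p q) \<le> t (p x) (p q) + t (p y) (p z)"
      using four_point p by blast
    show "?t x y + ?t z q \<le> ?t x z + ?t y q \<or> ?t x y + ?t z q \<le> ?t x q + ?t y z"
      using fp * u p dist_sym[of u x] dist_sym[of u y] dist_sym[of u z] dist_sym[of u q]
        dist_tri[of z u q] dist_tri[of x u y]
      by (cases "x = w"; cases "y = w"; cases "z = w"; cases "q = w") (auto simp: p_def)
  qed
qed

section \<open>Breadth-first spanning trees\<close>

locale spanning_tree_metric = graph_metric V d + T: tree_metric V t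
  for V :: "'a set" and d t +
  assumes edge: "x \<in> V \<Longrightarrow> y \<in> V \<Longrightarrow> t x y = 1 \<Longrightarrow> d x y = 1"
begin

text \<open>
  Deleting edges never shortens distances.
\<close>

lemma dist_le_tree: "x \<in> V \<Longrightarrow> y \<in> V \<Longrightarrow> d x y \<le> t x y"
proof (induction "t x y" arbitrary: y)
  case 0
  then show ?case using T.dist_zero_iff by auto
next
  case (Suc m)
  then obtain z where z: "z \<in> V" "t x z = m" "t z y = 1"
    using T.dist_step[of x y m] by auto
  have "d x z \<le> m" using Suc.hyps(1)[of z] z Suc.prems by auto
  moreover have "d x y \<le> d x z + d z y" using dist_tri z Suc.prems by auto
  ultimately show ?case using edge[of z y] z Suc by auto
qed

lemma tree_nbrs: "x \<in> V \<Longrightarrow> T.nbrs x \<subseteq> nbrs x"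
  using edge by (auto simp: nbrs_def T.nbrs_def)

text \<open>
  In the case of equality all intermediate inequalities are tight; strict monotonicity then forces
  the tree to have diameter \<open>D\<close>, and every vertex has the same eccentricity in the graph as in the
  tree, so the graph has diameter \<open>D\<close> as well.
\<close>

lemma total_le_tree_diameter:
  assumes diam: "\<And>x y. x \<in> V \<Longrightarrow> y \<in> V \<Longrightarrow> t x y \<le> D" and "D < card V"
  shows "total \<le> extremal_total (card V) D"
    and "total = extremal_total (card V) D \<Longrightarrow>
      (\<forall>x\<in>V. \<forall>y\<in>V. d x y \<le> D) \<and> (\<exists>a\<in>V. \<exists>b\<in>V. d a b = D)"
proof -
  have fin: "finite (case_prod t ` (V \<times> V))" and ne: "case_prod t ` (V \<times> V) \<noteq> {}"
    using finite_V V_nonempty by auto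
  obtain a b where ab: "a \<in> V" "b \<in> V" "t a b = Max (case_prod t ` (V \<times> V))"
    using Max_in[OF fin ne] by auto
  have max: "t x y \<le> t a b" if "x \<in> V" "y \<in> V" for x y
    unfolding ab(3) using fin that by (intro Max_ge) auto
  have eccs: "ecc x \<le> T.ecc x" if "x \<in> V" for x
    using that dist_le_tree T.dist_le_ecc by (intro ecc_le) (meson order_trans)
  then have 1: "total \<le> T.total"
    unfolding total_def T.total_def by (rule sum_mono)
  have 2: "T.total \<le> extremal_total (card V) (t a b)"
    using T.total_le_diameter[OF ab(1,2)] max by blast
  have 3: "extremal_total (card V) (t a b) \<le> extremal_total (card V) D"
    using extremal_total_mono diam ab assms(2) by blast
  show "total \<le> extremal_total (card V) D" using 1 2 3 by simp
  assume eq: "total = extremal_total (card V) D"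
  then have "\<not> t a b < D"
    using extremal_total_strict_mono[of "t a b" D "card V"] assms(2) 1 2 by auto
  then have tD: "t a b = D" using diam[OF ab(1,2)] by simp
  have "total = T.total" using 1 2 3 eq by simp
  then have "ecc a = T.ecc a"
    unfolding total_def T.total_def
    using sum_mono_inv[of ecc V T.ecc a] eccs ab finite_V by auto
  moreover have "T.ecc a = D"
    using T.ecc_le[of a D] diam ab T.dist_le_ecc[of b a] tD by (metis le_antisym)
  moreover obtain y where "y \<in> V" "d a y = ecc a" using ecc_attained by blast
  ultimately have "\<exists>a\<in>V. \<exists>b\<in>V. d a b = D" using ab by auto
  moreover have "\<forall>x\<in>V. \<forall>y\<in>V. d x y \<le> D"
    using dist_le_tree diam by (meson order_trans)
  ultimately show "(\<forall>x\<in>V. \<forall>y\<in>V. d x y \<le> D) \<and> (\<exists>a\<in>V. \<exists>b\<in>V. d a b = D)" by blast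
qed

end

text \<open>
  The tree is grown by repeatedly attaching a missing vertex \<open>w\<close> that is closest to the root: its
  predecessor on a shortest path from \<open>r\<close> is already present, so distances from \<open>r\<close> are kept.
\<close>

lemma (in graph_metric) bfs_tree_exists:
  assumes r: "r \<in> V"
  shows "\<exists>t. spanning_tree_metric V d t \<and> (\<forall>x\<in>V. t r x = d r x)"
proof -
  have "\<exists>S t. S \<subseteq> V \<and> card S = Suc m \<and> r \<in> S \<and> tree_metric S t \<and> (\<forall>x\<in>S. t r x = d r x) \<and>
      (\<forall>x\<in>S. \<forall>y\<in>S. t x y = 1 \<longrightarrow> d x y = 1) \<and> (\<forall>x\<in>S. \<forall>y\<in>V. d r y < d r x \<longrightarrow> y \<in> S)"
    if "Suc m \<le> card V" for m
    using that
  proof (induction m)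
    case 0
    then show ?case
      using r tree_metric_singleton[of r] by (intro exI[of _ "{r}"] exI[of _ "\<lambda>_ _. 0"]) auto
  next
    case (Suc m)
    then obtain S t where S: "S \<subseteq> V" "card S = Suc m" "r \<in> S" and t: "tree_metric S t"
      and depth: "\<forall>x\<in>S. t r x = d r x" and edge: "\<forall>x\<in>S. \<forall>y\<in>S. t x y = 1 \<longrightarrow> d x y = 1"
      and down: "\<forall>x\<in>S. \<forall>y\<in>V. d r y < d r x \<longrightarrow> y \<in> S" by auto
    interpret T: tree_metric S t by (rule t)
    have "V - S \<noteq> {}" using S Suc.prems by (metis Diff_eq_empty_iff subset_antisym Suc_n_not_le_n)
    then obtain w where w: "w \<in> V - S" and min: "\<And>y. y \<in> V - S \<Longrightarrow> d r w \<le> d r y"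
      using ex_has_least_nat[of "\<lambda>y. y \<in> V - S" _ "d r"] by blast
    then obtain k where k: "d r w = Suc k"
      using r S dist_zero_iff[of r w] by (metis DiffD1 DiffD2 not0_implies_Suc)
    then obtain z where z: "z \<in> V" "d r z = k" "d z w = 1" using dist_step[OF r, of w] w by auto
    have zS: "z \<in> S" using min[of z] z k by force
    have zw: "d w z = 1" using z dist_sym[of z w] w by auto
    define t' where "t' = (\<lambda>x y. if x = w then (if y = w then 0 else Suc (t z y))
           else if y = w then Suc (t x z) else t x y)"
    have "tree_metric (insert w S) t'"
      unfolding t'_def using t zS w by (intro tree_metric_add_leaf) auto
    moreover have "\<forall>x\<in>insert w S. t' r x = d r x"
      using depth S w z k zS by (auto simp: t'_def)
    moreover have "\<forall>x\<in>insert w S. \<forall>y\<in>insert w S. t' x y = 1 \<longrightarrow> d x y = 1"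
      using edge w z zw zS T.dist_zero_iff by (auto simp: t'_def)
    moreover have "\<forall>x\<in>insert w S. \<forall>y\<in>V. d r y < d r x \<longrightarrow> y \<in> insert w S"
    proof (intro ballI impI)
      fix x y assume "x \<in> insert w S" "y \<in> V" "d r y < d r x"
      then show "y \<in> insert w S" using down min[of y] by (cases "x = w") auto
    qed
    moreover have "card (insert w S) = Suc (Suc m)"
      using S w T.finite_V by auto
    moreover have "insert w S \<subseteq> V" "r \<in> insert w S" using S w by auto
    ultimately show ?case by blast
  qed
  moreover have "Suc (card V - 1) = card V"
    using r finite_V card_gt_0_iff[of V] by auto
  ultimately obtain S t where S: "S \<subseteq> V" "card S = card V" and t: "tree_metric S t"
    "\<forall>x\<in>S. t r x = d r x" "\<forall>x\<in>S. \<forall>y\<in>S. t x y = 1 \<longrightarrow> d x y = 1"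
    by (metis le_refl)
  have "S = V" using S finite_V by (simp add: card_subset_eq)
  with t have "spanning_tree_metric V d t"
    by (intro spanning_tree_metric.intro spanning_tree_metric_axioms.intro)
      (auto intro: graph_metric_axioms)
  with t \<open>S = V\<close> show ?thesis by blast
qed

section \<open>Graphs with pendant vertices\<close>

lemma ex_two_distinct:
  assumes "2 \<le> card S" shows "\<exists>x\<in>S. \<exists>y\<in>S. x \<noteq> y"
proof (rule ccontr)
  assume "\<not> ?thesis"
  moreover have "finite S" using assms card.infinite by fastforce
  ultimately have "card S \<le> Suc 0" using card_le_Suc0_iff_eq by blast
  then show False using assms by simp
qed

context graph_metric
begin

definition pendants :: "'a set" where
  "pendants = {x \<in> V. card (nbrs x) = 1}"

lemma geodesic_interior_nbrs:
  assumes "geodesic D v" "0 < i" "i < D"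
  shows "2 \<le> card (nbrs (v i))"
proof -
  have "{v (i - 1), v (i + 1)} \<subseteq> nbrs (v i)"
    using nbrs_on_geodesic[OF assms(1)] assms(2,3) by auto
  moreover have "card {v (i - 1), v (i + 1)} = 2"
    using geodesic_eq_iff[OF assms(1), of "i - 1" "i + 1"] assms(2,3) by auto
  ultimately show ?thesis by (metis card_mono finite_nbrs)
qed

lemma geodesic_through_dist:
  assumes "geodesic D v" "x \<in> v ` {..D}"
  shows "x = v (d (v 0) x)" "d (v 0) x + d x (v D) = D"
  using assms geodesic_dist[OF assms(1)] by auto

end

context spanning_tree_metric
begin

text \<open>
  A pendant vertex of the graph is a leaf of each spanning tree and thus cannot be an inner vertex of
  a geodesic of the tree: at least \<open>card pendants - 2\<close> vertices are off the geodesic.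
\<close>

lemma tree_diameter_pendants:
  assumes "x \<in> V" "y \<in> V"
  shows "t x y + 1 + card pendants \<le> card V + 2"
proof -
  define D where "D = t x y"
  obtain v where v: "T.geodesic D v"
    using T.geodesic_exists[OF assms] by (auto simp: D_def)
  have "\<not> v i \<in> pendants" if "0 < i" "i < D" for i
  proof
    assume "v i \<in> pendants"
    then have "v i \<in> V" "card (nbrs (v i)) = 1" by (auto simp: pendants_def)
    moreover have "2 \<le> card (T.nbrs (v i))" using T.geodesic_interior_nbrs[OF v that] .
    moreover have "card (T.nbrs (v i)) \<le> card (nbrs (v i))"
      using tree_nbrs finite_nbrs \<open>v i \<in> V\<close> by (intro card_mono) auto
    ultimately show False by simp
  qed
  then have "pendants \<inter> v ` {..D} \<subseteq> {v 0, v D}"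
  proof -
    have "v i \<in> {v 0, v D}" if "i \<le> D" "v i \<in> pendants" for i
      using that \<open>\<And>i. 0 < i \<Longrightarrow> i < D \<Longrightarrow> \<not> v i \<in> pendants\<close>[of i] by (cases "i = 0"; cases "i = D") auto
    then show ?thesis by blast
  qed
  then have "card (pendants \<inter> v ` {..D}) \<le> card {v 0, v D}" by (intro card_mono) auto
  also have "\<dots> \<le> 2" by (simp add: card_insert_if)
  finally have "card (pendants \<inter> v ` {..D}) \<le> 2" .
  moreover have fin: "finite pendants" using finite_V by (simp add: pendants_def)
  moreover have "card (pendants \<union> v ` {..D}) + card (pendants \<inter> v ` {..D}) = card pendants + Suc D"
    using card_Un_Int[OF fin, of "v ` {..D}"] T.card_geodesic[OF v] by simp
  moreover have "card (pendants \<union> v ` {..D}) \<le> card V"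
    using T.geodesic_in[OF v] finite_V by (intro card_mono) (auto simp: pendants_def)
  ultimately show ?thesis by (simp add: D_def)
qed

end

context graph_metric
begin

theorem total_le_many_pendants:
  assumes "card pendants = k" "2 \<le> k"
  shows "total \<le> extremal_total (card V) (card V + 1 - k)"
proof -
  obtain r where "r \<in> V" using V_nonempty by blast
  then obtain t where "spanning_tree_metric V d t" using bfs_tree_exists by blast
  then interpret spanning_tree_metric V d t .
  have "0 < card V" using \<open>r \<in> V\<close> finite_V card_gt_0_iff by blast
  then show ?thesis
    using tree_diameter_pendants assms
    by (intro total_le_tree_diameter(1)) (force simp: algebra_simps)+
qed

text \<open>
  Here a geodesic from \<open>p\<close> to \<open>q\<close> contains all vertices, and \<open>q\<close> can only be adjacent to its
  predecessor.
\<close>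

lemma far_end_of_spanning_geodesic_pendant:
  assumes "p \<in> V" "q \<in> V" "d p q + 1 = card V" "p \<noteq> q"
  shows "q \<in> pendants"
proof -
  define D where "D = d p q"
  obtain v where v: "geodesic D v" "v 0 = p" "v D = q"
    using geodesic_exists[OF assms(1,2)] by (auto simp: D_def)
  have "card (V - v ` {..D}) = 0" using card_off_geodesic[OF v(1)] assms by (simp add: D_def)
  then have "V \<subseteq> v ` {..D}" using finite_V by auto
  then have "nbrs q \<subseteq> v ` {..D}" by (auto simp: nbrs_def)
  moreover have D0: "0 < D" using assms dist_zero_iff by (auto simp: D_def)
  ultimately have "nbrs q = {v (D - 1)}"
    using nbrs_on_geodesic[OF v(1), of D] v(3) by force
  then show ?thesis using assms by (simp add: pendants_def)
qed

text \<open>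
  The spanning tree is rooted at the pendant vertex \<open>p\<close>. If it had diameter \<open>n - 1\<close>, it would
  be a Hamiltonian path with end \<open>p\<close>. Since distances from the root are those of the graph, the
  other end would have distance \<open>n - 1\<close> from \<open>p\<close> in the graph, hence be a second pendant vertex.
\<close>

theorem total_one_pendant:
  assumes "card pendants = 1" "2 \<le> card V"
  shows "total \<le> extremal_total (card V) (card V - 2)"
    and "total = extremal_total (card V) (card V - 2) \<Longrightarrow>
      (\<forall>x\<in>V. \<forall>y\<in>V. d x y \<le> card V - 2) \<and> (\<exists>a\<in>V. \<exists>b\<in>V. d a b = card V - 2)"
proof -
  obtain p where p: "pendants = {p}" using assms(1) card_1_singletonE by blast
  then have pV: "p \<in> V" "card (nbrs p) = 1" by (auto simp: pendants_def)
  obtain t where "spanning_tree_metric V d t" and depth: "\<forall>x\<in>V. t p x = d p x"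
    using bfs_tree_exists[OF pV(1)] by blast
  then interpret spanning_tree_metric V d t by simp
  have diam: "t x y \<le> card V - 2" if xy: "x \<in> V" "y \<in> V" for x y
  proof (rule ccontr)
    assume "\<not> t x y \<le> card V - 2"
    then have D: "t x y + 1 = card V" using T.dist_less_card[OF xy] by simp
    obtain v where v: "T.geodesic (t x y) v" "v 0 = x" "v (t x y) = y"
      using T.geodesic_exists[OF xy] by auto
    have "card (V - v ` {..t x y}) = 0" using T.card_off_geodesic[OF v(1)] D by simp
    then have "p \<in> v ` {..t x y}" using finite_V pV by auto
    then obtain i where i: "i \<le> t x y" "p = v i" by auto
    have "\<not> (0 < i \<and> i < t x y)"
    proof
      assume "0 < i \<and> i < t x y"
      then have "2 \<le> card (T.nbrs p)" using T.geodesic_interior_nbrs[OF v(1)] i by auto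
      moreover have "card (T.nbrs p) \<le> card (nbrs p)"
        using tree_nbrs finite_nbrs pV by (intro card_mono) auto
      ultimately show False using pV by simp
    qed
    then have "p = x \<or> p = y" using i v by (auto simp: le_less)
    then obtain q where q: "q \<in> V" "t p q = t x y" using xy T.dist_sym by metis
    then have "d p q + 1 = card V" using depth D by auto
    moreover have "p \<noteq> q" using q D assms(2) pV by auto
    ultimately have "q \<in> pendants" using far_end_of_spanning_geodesic_pendant pV q by blast
    then show False using p \<open>p \<noteq> q\<close> by auto
  qed
  show "total \<le> extremal_total (card V) (card V - 2)"
    using diam assms(2) by (intro total_le_tree_diameter(1)) auto
  show "total = extremal_total (card V) (card V - 2) \<Longrightarrow>
      (\<forall>x\<in>V. \<forall>y\<in>V. d x y \<le> card V - 2) \<and> (\<exists>a\<in>V. \<exists>b\<in>V. d a b = card V - 2)"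
    using diam assms(2) by (intro total_le_tree_diameter(2)) auto
qed

section \<open>Graphs without pendant vertices\<close>

text \<open>
  \<open>A\<close> is a union of components of the graph without the vertex \<open>c\<close>: edges leave \<open>A\<close> only
  towards \<open>c\<close>.
\<close>

definition hangs_at :: "'a set \<Rightarrow> 'a \<Rightarrow> bool" where
  "hangs_at A c \<longleftrightarrow> A \<noteq> {} \<and> A \<subseteq> V \<and> c \<in> V - A \<and> (\<forall>x\<in>A. nbrs x \<subseteq> insert c A)"

lemma dist_through_cut:
  assumes "hangs_at A c" "x \<in> V - A" "y \<in> A"
  shows "d x y = d x c + d c y"
  using assms(3)
proof (induction "d x y" arbitrary: y)
  case 0
  then show ?case using assms dist_zero_iff[of x y] by (auto simp: hangs_at_def)
next
  case (Suc m)
  have V: "x \<in> V" "y \<in> V" "c \<in> V" using assms Suc.prems by (auto simp: hangs_at_def)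
  obtain z where z: "z \<in> V" "d x z = m" "d z y = 1"
    using dist_step[of x y m] Suc V by auto
  then have "z \<in> nbrs y" using dist_sym V by (auto simp: nbrs_def)
  then have "z = c \<or> z \<in> A" using assms(1) Suc.prems by (auto simp: hangs_at_def)
  then show ?case
  proof
    assume "z = c" then show ?thesis using z Suc by simp
  next
    assume "z \<in> A"
    then have "m = d x c + d c z" using Suc.hyps(1)[of z] z by auto
    moreover have "d c y \<le> d c z + d z y" "d x y \<le> d x c + d c y"
      using dist_tri V z(1) by blast+
    ultimately show ?thesis using z Suc.hyps(2) by simp
  qed
qed

text \<open>
  If \<open>c\<close> has a single neighbour \<open>z\<close> in \<open>A\<close>, then \<open>z\<close> is itself a cut vertex and the rest of
  \<open>A\<close> hangs at \<open>z\<close>; it is nonempty because \<open>z\<close> is not pendant. Iterating ends at a set that is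
  joined to its cut vertex by at least two edges.
\<close>

lemma end_block_exists:
  assumes "hangs_at A c" "\<And>x. x \<in> A \<Longrightarrow> 2 \<le> card (nbrs x)"
  shows "\<exists>A' c'. hangs_at A' c' \<and> A' \<subseteq> A \<and> 2 \<le> card (nbrs c' \<inter> A')"
  using assms
proof (induction "card A" arbitrary: A c rule: less_induct)
  case less
  note A = less.prems(1)[unfolded hangs_at_def]
  show ?case
  proof (cases "2 \<le> card (nbrs c \<inter> A)")
    case True
    then show ?thesis using less.prems(1) by blast
  next
    case False
    obtain y where y: "y \<in> A" using A by blast
    then obtain m where m: "d y c = Suc m"
      using A dist_zero_iff[of y c] by (metis DiffD1 DiffD2 not0_implies_Suc subsetD)
    then obtain z where z: "z \<in> V" "d y z = m" "d z c = 1"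
      using dist_step[of y c m] y A by auto
    have "z \<in> A"
    proof (rule ccontr)
      assume "z \<notin> A"
      then have "d z y = d z c + d c y" using dist_through_cut[OF less.prems(1)] z y by auto
      then show False using z m y A dist_sym[of z y] dist_sym[of c y] by auto
    qed
    then have "z \<in> nbrs c \<inter> A" using z A dist_sym[of z c] by (auto simp: nbrs_def)
    moreover have "finite (nbrs c \<inter> A)" by (simp add: finite_nbrs)
    moreover have "card (nbrs c \<inter> A) \<le> Suc 0" using False by simp
    ultimately have only: "nbrs c \<inter> A = {z}"
      using card_le_Suc0_iff_eq[of "nbrs c \<inter> A"] by blast
    have "A - {z} \<noteq> {}"
    proof
      assume "A - {z} = {}"
      moreover have "z \<notin> nbrs z" using z by (simp add: nbrs_def)
      ultimately have "nbrs z \<subseteq> {c}" using A \<open>z \<in> A\<close> by blast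
      then have "card (nbrs z) \<le> 1" using card_mono[of "{c}" "nbrs z"] by simp
      then show False using less.prems(2)[OF \<open>z \<in> A\<close>] by simp
    qed
    moreover have "nbrs x \<subseteq> insert z (A - {z})" if x: "x \<in> A - {z}" for x
    proof -
      have "c \<notin> nbrs x"
      proof
        assume "c \<in> nbrs x"
        then have "x \<in> nbrs c \<inter> A" using x A dist_sym[of x c] by (auto simp: nbrs_def)
        then show False using only x by auto
      qed
      then show ?thesis using A x by blast
    qed
    ultimately have "hangs_at (A - {z}) z"
      using A z(1) unfolding hangs_at_def by blast
    moreover have "finite A" using A finite_V finite_subset by blast
    then have "card (A - {z}) < card A" using \<open>z \<in> A\<close> by (rule card_Diff1_less)
    moreover have "\<And>x. x \<in> A - {z} \<Longrightarrow> 2 \<le> card (nbrs x)" using less.prems(2) by blast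
    ultimately obtain A' c' where "hangs_at A' c'" "A' \<subseteq> A - {z}" "2 \<le> card (nbrs c' \<inter> A')"
      using less.hyps[of "A - {z}" z] by blast
    then show ?thesis by blast
  qed
qed

text \<open>
  The vertices are split into layers by their distance from \<open>x\<close>. If every layer strictly between
  \<open>x\<close> and the last one had two vertices, there would be at least \<open>2 * ecc x\<close> vertices. A layer
  with one vertex separates the earlier layers from the later ones.
\<close>

lemma large_ecc_imp_cut_vertex:
  assumes x: "x \<in> V" and large: "card V < 2 * ecc x"
  shows "\<exists>A B c. hangs_at A c \<and> hangs_at B c \<and> A \<inter> B = {}"
proof -
  define L where "L i = {y \<in> V. d x y = i}" for i
  define e where "e = ecc x"
  obtain far where far: "far \<in> V" "d x far = e" using ecc_attained by (auto simp: e_def)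
  obtain v where v: "geodesic e v" "v 0 = x" "v e = far"
    using geodesic_exists[OF x far(1)] far by auto
  have e0: "0 < e" using large by (simp add: e_def)
  have finL: "finite (L i)" for i using finite_V by (simp add: L_def)
  have vL: "v i \<in> L i" if "i \<le> e" for i
    using that geodesic_in[OF v(1)] geodesic_dist[OF v(1), of 0 i] v(2) by (auto simp: L_def)
  have "\<exists>i. 0 < i \<and> i < e \<and> L i = {v i}"
  proof (rule ccontr)
    assume no: "\<not> ?thesis"
    have two: "2 \<le> card (L i)" if "0 < i" "i < e" for i
    proof (rule ccontr)
      assume "\<not> 2 \<le> card (L i)"
      then have "card (L i) \<le> Suc 0" by simp
      then have "L i = {v i}" using vL[of i] that card_le_Suc0_iff_eq[OF finL, of i] by auto
      then show False using no that by blast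
    qed
    have one: "1 \<le> card (L i)" if "i \<le> e" for i
      using vL[OF that] finL[of i] card_gt_0_iff[of "L i"] by fastforce
    have "2 * e = (\<Sum>i\<in>{1..<e}. 2) + 2" using e0 by simp
    also have "\<dots> \<le> (\<Sum>i\<in>{1..<e}. card (L i)) + (card (L 0) + card (L e))"
      using two one[of 0] one[of e] by (intro add_mono sum_mono) auto
    also have "\<dots> = (\<Sum>i\<in>insert 0 (insert e {1..<e}). card (L i))" using e0 by simp
    also have "\<dots> = card (\<Union>i\<in>insert 0 (insert e {1..<e}). L i)"
      using finL by (intro card_UN_disjoint [symmetric]) (auto simp: L_def)
    also have "\<dots> \<le> card V" using finite_V by (intro card_mono) (auto simp: L_def)
    finally show False using large by (simp add: e_def)
  qed
  then obtain i where i: "0 < i" "i < e" "L i = {v i}" by blast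
  have near: "d x z \<le> Suc (d x y) \<and> d x y \<le> Suc (d x z)" if "y \<in> V" "z \<in> nbrs y" for y z
    using that dist_tri[OF x, of y z] dist_tri[OF x, of z y] dist_sym[of y z]
    by (auto simp: nbrs_def)
  have vi: "v i \<in> V" "d x (v i) = i" using vL[of i] i by (auto simp: L_def)
  have single: "y = v i" if "y \<in> V" "d x y = i" for y using that i(3) by (auto simp: L_def)
  have sub: "nbrs y \<subseteq> V" for y by (auto simp: nbrs_def)
  have "hangs_at {y \<in> V. d x y < i} (v i)"
    unfolding hangs_at_def
  proof (intro conjI ballI)
    show "{y \<in> V. d x y < i} \<noteq> {}" using x i by force
    show "nbrs y \<subseteq> insert (v i) {y \<in> V. d x y < i}" if "y \<in> {y \<in> V. d x y < i}" for y
    proof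
      fix z assume z: "z \<in> nbrs y"
      then have "d x z \<le> i" "z \<in> V" using near[of y z] that sub by auto
      then show "z \<in> insert (v i) {y \<in> V. d x y < i}" using single[of z] by (cases "d x z = i") auto
    qed
  qed (use vi in auto)
  moreover have "hangs_at {y \<in> V. i < d x y} (v i)"
    unfolding hangs_at_def
  proof (intro conjI ballI)
    show "{y \<in> V. i < d x y} \<noteq> {}" using far i by force
    show "nbrs y \<subseteq> insert (v i) {y \<in> V. i < d x y}" if "y \<in> {y \<in> V. i < d x y}" for y
    proof
      fix z assume z: "z \<in> nbrs y"
      then have "i \<le> d x z" "z \<in> V" using near[of y z] that sub by auto
      then show "z \<in> insert (v i) {y \<in> V. i < d x y}" using single[of z] by (cases "d x z = i") auto
    qed
  qed (use vi in auto)
  moreover have "{y \<in> V. d x y < i} \<inter> {y \<in> V. i < d x y} = {}" by auto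
  ultimately show ?thesis by (intro exI conjI)
qed

end

context spanning_tree_metric
begin

text \<open>
  By \<open>dist_through_cut\<close>, in a breadth-first tree whose root lies outside \<open>A\<close> all neighbours of
  \<open>c\<close> in \<open>A\<close> are tree neighbours of \<open>c\<close>, hence equally far from every vertex outside \<open>A\<close>. A
  geodesic of the tree with an end outside \<open>A\<close> therefore misses one of them, and a geodesic with
  both ends outside \<open>A\<close> misses \<open>A\<close> completely, because entering and leaving would both lead
  through \<open>c\<close>. With two disjoint sets of this kind, every geodesic misses at least two vertices.
\<close>

lemma tree_diameter_two_end_blocks:
  assumes A: "hangs_at A c" "2 \<le> card (nbrs c \<inter> A)"
    and B: "hangs_at B e" "2 \<le> card (nbrs e \<inter> B)"
    and disj: "A \<inter> B = {}"
    and r: "r \<in> V" "r \<notin> A" "r \<notin> B" and depth: "\<forall>x\<in>V. t r x = d r x"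
    and xy: "x \<in> V" "y \<in> V"
  shows "t x y + 3 \<le> card V"
proof -
  have tree_hangs: "T.hangs_at A c" if "hangs_at A c" for A c
    using that tree_nbrs unfolding T.hangs_at_def hangs_at_def by blast
  define D where "D = t x y"
  obtain v where v: "T.geodesic D v" "v 0 = x" "v D = y"
    using T.geodesic_exists[OF xy] by (auto simp: D_def)
  let ?P = "v ` {..D}"
  have on_P: "t x z + t z y = D" "z = v (t x z)" "z = v (D - t z y)" if "z \<in> ?P" for z
    using T.geodesic_through_dist[OF v(1) that] v(2,3) by auto
  have miss: "\<exists>z\<in>A. z \<notin> ?P"
    if h: "hangs_at A c" "2 \<le> card (nbrs c \<inter> A)" "r \<notin> A" and out: "x \<notin> A \<or> y \<notin> A" for A c
  proof -
    have AV: "A \<subseteq> V" and cV: "c \<in> V" using h by (auto simp: hangs_at_def)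
    have child: "t c z = 1" if "z \<in> nbrs c \<inter> A" for z
    proof -
      have "t r z = t r c + t c z" "d r z = d r c + d c z"
        using T.dist_through_cut[OF tree_hangs[OF h(1)]] dist_through_cut[OF h(1)] that h r by auto
      then show ?thesis using depth that AV cV by (auto simp: nbrs_def)
    qed
    obtain z1 z2 where z: "z1 \<in> nbrs c \<inter> A" "z2 \<in> nbrs c \<inter> A" "z1 \<noteq> z2"
      using ex_two_distinct[OF h(2)] by blast
    have "\<not> (z1 \<in> ?P \<and> z2 \<in> ?P)"
    proof
      assume P: "z1 \<in> ?P \<and> z2 \<in> ?P"
      have eq: "t w z1 = t w z2" if "w \<in> V" "w \<notin> A" for w
        using T.dist_through_cut[OF tree_hangs[OF h(1)], of w] that z child by simp
      from out show False
      proof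
        assume "x \<notin> A"
        then show False using eq[OF xy(1)] on_P(2)[of z1] on_P(2)[of z2] P z(3) by simp
      next
        assume "y \<notin> A"
        then have "t z1 y = t z2 y"
          using eq[OF xy(2)] T.dist_sym[of _ y] xy z AV by (metis IntE subsetD)
        then show False using on_P(3)[of z1] on_P(3)[of z2] P z(3) by simp
      qed
    qed
    then show ?thesis using z by blast
  qed
  have miss_all: "A \<inter> ?P = {}"
    if h: "hangs_at A c" and out: "x \<notin> A" "y \<notin> A" for A c
  proof (rule ccontr)
    assume "A \<inter> ?P \<noteq> {}"
    then obtain z where z: "z \<in> A" "z \<in> ?P" by blast
    have V: "c \<in> V" "z \<in> V" "z \<noteq> c" using h z by (auto simp: hangs_at_def)
    have "t x z = t x c + t c z" "t y z = t y c + t c z"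
      using T.dist_through_cut[OF tree_hangs[OF h]] z out xy by auto
    moreover have "t x z + t z y = t x y" using on_P(1)[OF z(2)] by (simp add: D_def)
    moreover have "t x y \<le> t x c + t c y" using T.dist_tri V xy by blast
    moreover have "t z y = t y z" "t y c = t c y" using T.dist_sym V xy by auto
    moreover have "t c z \<noteq> 0" using T.dist_zero_iff V by auto
    ultimately show False by linarith
  qed
  have two_in: "\<exists>z1\<in>A. \<exists>z2\<in>A. z1 \<noteq> z2" if "2 \<le> card (nbrs c \<inter> A)" for A c
    using ex_two_distinct[OF that] by blast
  have "\<exists>z1\<in>V - ?P. \<exists>z2\<in>V - ?P. z1 \<noteq> z2"
  proof -
    have AV: "A \<subseteq> V" "B \<subseteq> V" using A B by (auto simp: hangs_at_def)
    consider "x \<in> A" "y \<in> A" | "x \<in> B" "y \<in> B"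
      | "x \<notin> A \<or> y \<notin> A" "x \<notin> B \<or> y \<notin> B" by blast
    then show ?thesis
    proof cases
      case 1
      then have "B \<inter> ?P = {}" using miss_all[OF B(1)] disj by blast
      then show ?thesis using two_in[OF B(2)] AV by blast
    next
      case 2
      then have "A \<inter> ?P = {}" using miss_all[OF A(1)] disj by blast
      then show ?thesis using two_in[OF A(2)] AV by blast
    next
      case 3
      obtain z1 where "z1 \<in> A" "z1 \<notin> ?P" using miss[OF A r(2) 3(1)] by blast
      moreover obtain z2 where "z2 \<in> B" "z2 \<notin> ?P" using miss[OF B r(3) 3(2)] by blast
      ultimately show ?thesis using disj AV by (intro bexI[of _ z1] bexI[of _ z2]) auto
    qed
  qed
  then have "\<not> card (V - ?P) \<le> Suc 0"
    using card_le_Suc0_iff_eq[of "V - ?P"] finite_V by auto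
  then show ?thesis using T.card_off_geodesic[OF v(1)] by (simp add: D_def)
qed

end

text \<open>
  Either all eccentricities are at most half the number of vertices, and then the bound is not
  attained, or there is a cut vertex; an end block on each of its two sides gives a spanning tree
  of diameter at most \<open>n - 3\<close>.
\<close>

theorem (in graph_metric) total_no_pendants:
  assumes deg: "\<And>x. x \<in> V \<Longrightarrow> 2 \<le> card (nbrs x)" and n: "7 \<le> card V"
  shows "total \<le> extremal_total (card V) (card V - 3)"
    and "total = extremal_total (card V) (card V - 3) \<Longrightarrow>
      (\<forall>x\<in>V. \<forall>y\<in>V. d x y \<le> card V - 3) \<and> (\<exists>a\<in>V. \<exists>b\<in>V. d a b = card V - 3)"
proof -
  have "total < extremal_total (card V) (card V - 3) \<or>
    total \<le> extremal_total (card V) (card V - 3) \<and>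
    (total = extremal_total (card V) (card V - 3) \<longrightarrow>
      (\<forall>x\<in>V. \<forall>y\<in>V. d x y \<le> card V - 3) \<and> (\<exists>a\<in>V. \<exists>b\<in>V. d a b = card V - 3))"
  proof (cases "\<forall>x\<in>V. 2 * ecc x \<le> card V")
    case True
    then have "total \<le> card V * (card V div 2)"
      by (intro total_cong_le) (auto simp: less_eq_div_iff_mult_less_eq mult.commute)
    then show ?thesis using half_bound_less_extremal[OF n] by simp
  next
    case False
    then obtain A B c where *: "hangs_at A c" "hangs_at B c" "A \<inter> B = {}"
      using large_ecc_imp_cut_vertex by (meson not_le)
    have sub: "A \<subseteq> V" "B \<subseteq> V" "c \<in> V" "c \<notin> A" "c \<notin> B" using * by (auto simp: hangs_at_def)
    obtain A' a where A': "hangs_at A' a" "A' \<subseteq> A" "2 \<le> card (nbrs a \<inter> A')"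
      using end_block_exists[OF *(1)] deg sub by blast
    obtain B' b where B': "hangs_at B' b" "B' \<subseteq> B" "2 \<le> card (nbrs b \<inter> B')"
      using end_block_exists[OF *(2)] deg sub by blast
    obtain t where "spanning_tree_metric V d t" and depth: "\<forall>x\<in>V. t c x = d c x"
      using bfs_tree_exists[OF sub(3)] by blast
    then interpret spanning_tree_metric V d t by simp
    have diam: "t x y \<le> card V - 3" if "x \<in> V" "y \<in> V" for x y
    proof -
      have "A' \<inter> B' = {}" "c \<notin> A'" "c \<notin> B'" using * A' B' sub by auto
      then show ?thesis
        using tree_diameter_two_end_blocks[OF A'(1,3) B'(1,3) _ sub(3) _ _ depth that] by simp
    qed
    have "card V - 3 < card V" using n by simp
    then show ?thesis using total_le_tree_diameter[OF diam] by blast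
  qed
  then show "total \<le> extremal_total (card V) (card V - 3)"
    and "total = extremal_total (card V) (card V - 3) \<Longrightarrow>
      (\<forall>x\<in>V. \<forall>y\<in>V. d x y \<le> card V - 3) \<and> (\<exists>a\<in>V. \<exists>b\<in>V. d a b = card V - 3)"
    by auto
qed

section \<open>Graphs attaining the bounds\<close>

lemma image_reverse: "(\<lambda>i. v (D - i)) ` {..D} = v ` {..D::nat}"
proof -
  have "(\<lambda>i. D - i) ` {..D} = {..D}"
  proof
    show "{..D} \<subseteq> (\<lambda>i. D - i) ` {..D}"
    proof
      fix i assume "i \<in> {..D}"
      then show "i \<in> (\<lambda>i. D - i) ` {..D}" by (intro image_eqI[of _ _ "D - i"]) auto
    qed
  qed auto
  then have "v ` (\<lambda>i. D - i) ` {..D} = v ` {..D}" by (rule arg_cong)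
  then show ?thesis by (simp only: image_image)
qed

context graph_metric
begin

text \<open>
  The vertex \<open>w\<close> off the geodesic is adjacent to its first vertex and to its second or third. It
  then reaches every \<open>v\<^sub>i\<close> about as fast as \<open>v\<^sub>0\<close> does, so it does not raise the eccentricities on
  the geodesic; and if it is adjacent to \<open>v\<^sub>2\<close>, it stays closer than \<open>D\<close> to the whole geodesic, so
  that the total falls short of the bound.
\<close>

lemma companion_dist:
  assumes v: "geodesic D v" and D: "3 \<le> D" and w: "w \<in> V" "d w (v 0) = 1" "d w (v j) = 1"
    and j: "j = 1 \<or> j = 2" and i: "i \<le> D"
  shows "d w (v i) \<le> max i (D - i)" "j = 2 \<Longrightarrow> d w (v i) < D"
proof -
  have tri: "d w (v i) \<le> 1 + d (v 0) (v i)" "d w (v i) \<le> 1 + d (v j) (v i)"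
    using dist_tri[of w "v 0" "v i"] dist_tri[of w "v j" "v i"] w j D i geodesic_in[OF v] by auto
  have "d (v 0) (v i) = i" "d (v j) (v i) = (j - i) + (i - j)"
    using geodesic_dist[OF v] i j D by auto
  then have "d w (v i) \<le> 1 + i" "d w (v i) \<le> 1 + ((j - i) + (i - j))" using tri by auto
  then show "d w (v i) \<le> max i (D - i)" "j = 2 \<Longrightarrow> d w (v i) < D"
    using j D i w(2) by (cases "i = 0"; auto)+
qed

lemma nbrs_of_companion:
  assumes v: "geodesic D v" and w: "w \<in> V" "d w (v 0) = 1" and j: "j \<le> D" "v j \<in> nbrs w"
  shows "j \<le> 2"
proof -
  have V: "v 0 \<in> V" "v j \<in> V" using geodesic_in[OF v] j by auto
  have "d (v 0) (v j) \<le> d (v 0) w + d w (v j)" using dist_tri V w by auto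
  moreover have "d (v 0) w = 1" "d w (v j) = 1" "d (v 0) (v j) = j"
    using w j V dist_sym[of w "v 0"] geodesic_dist[OF v, of 0 j] by (auto simp: nbrs_def)
  ultimately show ?thesis by simp
qed

text \<open>
  One vertex \<open>w\<close> is off a diametral geodesic. An end of the geodesic that is not adjacent to \<open>w\<close>
  is pendant, so \<open>w\<close> is adjacent to an end, say \<open>v\<^sub>0\<close>, and to only one, as otherwise \<open>D = 2\<close> and the
  four vertices form a cycle. It has a further neighbour, as
  otherwise \<open>w\<close> and \<open>v\<^sub>D\<close> were both pendant, and this neighbour is \<open>v\<^sub>1\<close>: with \<open>v\<^sub>2\<close> the
  total would be too small.
\<close>

theorem extremal_one_pendant:
  assumes pend: "card pendants = 1" and card: "card V = D + 2" and D: "2 \<le> D"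
    and diam: "\<And>x y. x \<in> V \<Longrightarrow> y \<in> V \<Longrightarrow> d x y \<le> D"
    and ab: "a \<in> V" "b \<in> V" "d a b = D"
    and extremal: "total = extremal_total (card V) D"
  shows "\<exists>v w. geodesic D v \<and> V = insert w (v ` {..D}) \<and> w \<notin> v ` {..D} \<and> nbrs w = {v 0, v 1}"
proof -
  have extremal_side: "nbrs w = {v 0, v 1}"
    if v: "geodesic D v" and V: "V = insert w (v ` {..D})" "w \<notin> v ` {..D}"
      and w0: "d w (v 0) = 1" and wD: "v D \<notin> nbrs w" for v w
  proof -
    have wV: "w \<in> V" and vV: "\<And>i. i \<le> D \<Longrightarrow> v i \<in> V" using V by auto
    have two: "v 2 \<notin> nbrs w"
    proof
      assume w2: "v 2 \<in> nbrs w"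
      then have D3: "3 \<le> D" using wD D by (cases "D = 2") auto
      note close = companion_dist[OF v D3 wV w0, of 2]
      have "total < extremal_total (card V) D"
      proof (rule total_le_geodesic(2)[OF v])
        show "\<exists>x\<in>V - v ` {..D}. ecc x < D"
        proof
          have "ecc w \<le> D - 1"
          proof (rule ecc_le)
            fix y assume "y \<in> V"
            then consider "y = w" | i where "i \<le> D" "y = v i" using V by blast
            then show "d w y \<le> D - 1"
            proof cases
              case 2
              then show ?thesis using close(2)[of i] w2 by (auto simp: nbrs_def)
            qed (use wV in auto)
          qed
          then show "ecc w < D" using D3 by simp
        qed (use V in auto)
      next
        show "ecc x \<le> D" if "x \<in> V - v ` {..D}" for x using diam that by (intro ecc_le) auto
      next
        fix i assume i: "i \<le> D"
        show "ecc (v i) \<le> max i (D - i)"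
        proof (rule ecc_le)
          fix y assume "y \<in> V"
          then consider "y = w" | j where "j \<le> D" "y = v j" using V by blast
          then show "d (v i) y \<le> max i (D - i)"
            using close(1)[OF _ _ i] w2 dist_sym[OF vV[OF i] wV] geodesic_dist[OF v i]
            by cases (auto simp: nbrs_def)
        qed
      qed
      then show False using extremal by simp
    qed
    have "nbrs w \<subseteq> {v 0, v 1}"
    proof
      fix y assume y: "y \<in> nbrs w"
      then have "y \<in> V" "y \<noteq> w" using wV by (auto simp: nbrs_def)
      then obtain j where j: "j \<le> D" "y = v j" using V(1) by blast
      then have "j \<le> 2" using nbrs_of_companion[OF v wV w0] y by auto
      moreover have "j \<noteq> 2" using two y j by auto
      ultimately have "j = 0 \<or> j = 1" by linarith
      then show "y \<in> {v 0, v 1}" using j by auto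
    qed
    moreover have "nbrs w \<noteq> {v 0}"
    proof
      assume "nbrs w = {v 0}"
      then have "w \<in> pendants" using wV by (simp add: pendants_def)
      moreover have "v D \<in> pendants"
      proof -
        have "w \<notin> nbrs (v D)" using wD dist_sym[of w "v D"] wV vV by (auto simp: nbrs_def)
        moreover have "nbrs (v D) \<subseteq> V" by (auto simp: nbrs_def)
        ultimately have "nbrs (v D) \<subseteq> v ` {..D}" using V(1) by blast
        then have "nbrs (v D) = {v (D - 1)}"
          using nbrs_on_geodesic[OF v, of D] D by force
        then show ?thesis using vV by (simp add: pendants_def)
      qed
      ultimately show False using pend V(2) by (auto simp: card_1_singleton_iff)
    qed
    moreover have "v 0 \<in> nbrs w" using w0 vV by (simp add: nbrs_def)
    ultimately show ?thesis by blast
  qed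
  obtain v where v: "geodesic D v" "v 0 = a" "v D = b" using geodesic_exists ab by blast
  have "card (V - v ` {..D}) = 1" using card_off_geodesic[OF v(1)] card by simp
  then obtain w where w: "V - v ` {..D} = {w}" using card_1_singletonE by blast
  then have V: "V = insert w (v ` {..D})" "w \<notin> v ` {..D}"
    using geodesic_in[OF v(1)] by auto
  have wV: "w \<in> V" and vV: "\<And>i. i \<le> D \<Longrightarrow> v i \<in> V" using V by auto
  have end_pendant: "v i \<in> pendants" if "i = 0 \<or> i = D" "v i \<notin> nbrs w" for i
  proof -
    have i: "i \<le> D" using that by auto
    have "w \<notin> nbrs (v i)" using that dist_sym[OF wV vV[OF i]] vV[OF i] by (auto simp: nbrs_def)
    moreover have "nbrs (v i) \<subseteq> V" by (auto simp: nbrs_def)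
    ultimately have "nbrs (v i) \<subseteq> v ` {..D}" using V(1) by blast
    then have "nbrs (v i) = {v (if i = 0 then 1 else D - 1)}"
      using nbrs_on_geodesic[OF v(1) i] D that(1) by (auto split: if_splits)
    then show ?thesis using vV[OF i] by (simp add: pendants_def)
  qed
  have "v 0 \<noteq> v D" using geodesic_eq_iff[OF v(1), of 0 D] D by auto
  moreover obtain p where "pendants = {p}" using pend card_1_singletonE by blast
  moreover have "v 0 \<in> nbrs w \<or> v 0 \<in> pendants" "v D \<in> nbrs w \<or> v D \<in> pendants"
    using end_pendant[of 0] end_pendant[of D] by auto
  ultimately have "v 0 \<in> nbrs w \<or> v D \<in> nbrs w" by (metis singletonD)
  then consider "v 0 \<in> nbrs w" "v D \<notin> nbrs w" | "v D \<in> nbrs w" "v 0 \<notin> nbrs w"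
    | "v 0 \<in> nbrs w" "v D \<in> nbrs w"
    by blast
  then show ?thesis
  proof cases
    case 1
    then have "nbrs w = {v 0, v 1}" using extremal_side[OF v(1) V] by (simp add: nbrs_def)
    then show ?thesis using v(1) V by blast
  next
    case 2
    have im: "(\<lambda>i. v (D - i)) ` {..D} = v ` {..D}"
      by (rule image_reverse)
    have V': "V = insert w ((\<lambda>i. v (D - i)) ` {..D})" "w \<notin> (\<lambda>i. v (D - i)) ` {..D}"
      unfolding im by (rule V)+
    have "nbrs w = {v (D - 0), v (D - 1)}"
      using extremal_side[OF geodesic_rev[OF v(1)] V'] 2 by (simp add: nbrs_def)
    then show ?thesis
      using geodesic_rev[OF v(1)] V' by (intro exI[of _ "\<lambda>i. v (D - i)"] exI[of _ w] conjI)
  next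
    case 3
    \<comment> \<open>Here the graph contains a 4-cycle through all vertices.\<close>
    have "D \<le> 2" using nbrs_of_companion[OF v(1) wV, of D] 3 by (auto simp: nbrs_def)
    then have D2: "D = 2" using D by simp
    have "2 \<le> card (nbrs x)" if x: "x \<in> V" for x
    proof -
      have two: "2 \<le> card (nbrs x)" if "p \<in> nbrs x" "q \<in> nbrs x" "p \<noteq> q" for p q
        using card_mono[OF finite_nbrs, of "{p, q}" x] that by simp
      have sw: "w \<in> nbrs (v 0)" "w \<in> nbrs (v D)"
        using 3 dist_sym[of w "v 0"] dist_sym[of w "v D"] wV vV by (auto simp: nbrs_def)
      have s1: "v 1 \<in> nbrs (v 0)" "v 1 \<in> nbrs (v D)" "v 0 \<in> nbrs (v 1)" "v D \<in> nbrs (v 1)"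
        using nbrs_on_geodesic[OF v(1)] D2 by auto
      have "w \<noteq> v 1" using V D2 by auto
      have "x = w \<or> x = v 0 \<or> x = v 1 \<or> x = v D"
        using x V D2 by (auto simp: le_Suc_eq numeral_2_eq_2)
      then show ?thesis
        using two[of "v 0" "v D"] two[of w "v 1"] 3 sw s1 \<open>w \<noteq> v 1\<close> \<open>v 0 \<noteq> v D\<close> by auto
    qed
    then have "pendants = {}" by (force simp: pendants_def)
    then show ?thesis using pend by simp
  qed
qed

text \<open>
  If the vertices \<open>w\<close> and \<open>w'\<close> at the two ends were adjacent, they would give a detour of length
  3 between the ends of the geodesic.
\<close>

lemma companion_nbrs_two_ends:
  assumes v: "geodesic D v" and D: "4 \<le> D"
    and V: "V = insert w (insert w' (v ` {..D}))" "w \<notin> v ` {..D}"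
    and w: "d w (v 0) = 1" "d w' (v D) = 1" and deg: "2 \<le> card (nbrs w)"
  shows "nbrs w \<subseteq> {v 0, v 1, v 2}" "v 1 \<in> nbrs w \<or> v 2 \<in> nbrs w"
proof -
  have wV: "w \<in> V" "w' \<in> V" and vV: "\<And>i. i \<le> D \<Longrightarrow> v i \<in> V" using V by auto
  have "w' \<notin> nbrs w"
  proof
    assume "w' \<in> nbrs w"
    then have "d w w' = 1" by (simp add: nbrs_def)
    moreover have "d (v 0) (v D) \<le> d (v 0) w + d w (v D)" "d w (v D) \<le> d w w' + d w' (v D)"
      using dist_tri wV vV by auto
    moreover have "d (v 0) (v D) = D" "d (v 0) w = 1"
      using geodesic_dist[OF v, of 0 D] dist_sym[of w "v 0"] w wV vV by auto
    ultimately show False using w D by simp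
  qed
  moreover have "w \<notin> nbrs w" using wV by (simp add: nbrs_def)
  moreover have "nbrs w \<subseteq> V" by (auto simp: nbrs_def)
  ultimately have "nbrs w \<subseteq> v ` {..D}" using V by auto
  then show sub: "nbrs w \<subseteq> {v 0, v 1, v 2}"
  proof (intro subsetI)
    fix y assume y: "y \<in> nbrs w"
    with \<open>nbrs w \<subseteq> v ` {..D}\<close> obtain j where j: "j \<le> D" "y = v j" by auto
    then have "j \<le> 2" using nbrs_of_companion[OF v wV(1) w(1)] y by auto
    then have "j = 0 \<or> j = 1 \<or> j = 2" by linarith
    then show "y \<in> {v 0, v 1, v 2}" using j by auto
  qed
  show "v 1 \<in> nbrs w \<or> v 2 \<in> nbrs w"
  proof (rule ccontr)
    assume "\<not> ?thesis"
    then have "nbrs w \<subseteq> {v 0}" using sub by auto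
    then have "card (nbrs w) \<le> 1" using card_mono[of "{v 0}"] by simp
    then show False using deg by simp
  qed
qed

text \<open>
  By its degree \<open>w\<close> is adjacent to \<open>v\<^sub>1\<close> or \<open>v\<^sub>2\<close>. Adjacency to \<open>v\<^sub>2\<close> would bring \<open>w\<close> closer
  than \<open>D\<close> to all vertices, \<open>w'\<close> included, while no other vertex exceeds its share of the
  extremal value.
\<close>

lemma extremal_end_triangle:
  assumes v: "geodesic D v" and D: "4 \<le> D"
    and V: "V = insert w (insert w' (v ` {..D}))" "w \<notin> v ` {..D}" "w' \<notin> v ` {..D}"
    and w: "d w (v 0) = 1" "d w' (v D) = 1"
    and deg: "2 \<le> card (nbrs w)" "2 \<le> card (nbrs w')"
    and diam: "\<And>x y. x \<in> V \<Longrightarrow> y \<in> V \<Longrightarrow> d x y \<le> D"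
    and extremal: "total = extremal_total (card V) D"
  shows "nbrs w = {v 0, v 1}"
proof -
  have wV: "w \<in> V" "w' \<in> V" and vV: "\<And>i. i \<le> D \<Longrightarrow> v i \<in> V" using V by auto
  have D3: "3 \<le> D" using D by simp
  define u where "u i = v (D - i)" for i
  have u: "geodesic D u" using geodesic_rev[OF v] by (simp add: u_def [abs_def])
  have im: "u ` {..D} = v ` {..D}"
    using image_reverse[of v D] by (simp add: u_def [abs_def])
  have w': "d w' (u 0) = 1" "d w (u D) = 1" using w by (auto simp: u_def)
  have V': "V = insert w' (insert w (u ` {..D}))" "w' \<notin> u ` {..D}" using V im by auto
  note W = companion_nbrs_two_ends[OF v D V(1,2) w deg(1)]
  note W' = companion_nbrs_two_ends[OF u D V' w' deg(2)]
  from W(2) obtain j where j: "j = 1 \<or> j = 2" "d w (v j) = 1" by (auto simp: nbrs_def)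
  from W'(2) obtain k where k: "k = 1 \<or> k = 2" "d w' (u k) = 1" by (auto simp: nbrs_def)
  have two: "v 2 \<notin> nbrs w"
  proof
    assume w2: "v 2 \<in> nbrs w"
    then have w2': "d w (v 2) = 1" by (simp add: nbrs_def)
    have "total < extremal_total (card V) D"
    proof (rule total_le_geodesic(2)[OF v])
      show "\<exists>x\<in>V - v ` {..D}. ecc x < D"
      proof
        have "ecc w \<le> D - 1"
        proof (rule ecc_le)
          fix y assume "y \<in> V"
          then consider "y = w" | "y = w'" | i where "i \<le> D" "y = v i" using V by blast
          then show "d w y \<le> D - 1"
          proof cases
            case 2
            have "d (v 2) w' \<le> d (v 2) (v (D - k)) + d (v (D - k)) w'"
              "d w w' \<le> d w (v 2) + d (v 2) w'"
              using dist_tri wV vV D by auto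
            moreover have "d (v 2) (v (D - k)) = D - k - 2"
              using geodesic_dist[OF v, of 2 "D - k"] k(1) D by auto
            moreover have "d (v (D - k)) w' = 1"
              using k dist_sym[of w' "v (D - k)"] wV vV by (auto simp: u_def)
            ultimately show ?thesis using 2 w2' k(1) D by auto
          next
            case 3
            then show ?thesis using companion_dist(2)[OF v D3 wV(1) w(1) w2'] by force
          qed (use wV in auto)
        qed
        then show "ecc w < D" using D by simp
      qed (use V in auto)
    next
      show "ecc x \<le> D" if "x \<in> V - v ` {..D}" for x using diam that by (intro ecc_le) auto
    next
      fix i assume i: "i \<le> D"
      show "ecc (v i) \<le> max i (D - i)"
      proof (rule ecc_le)
        fix y assume "y \<in> V"
        then consider "y = w" | "y = w'" | j where "j \<le> D" "y = v j" using V by blast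
        then show "d (v i) y \<le> max i (D - i)"
        proof cases
          case 1
          then show ?thesis
            using companion_dist(1)[OF v D3 wV(1) w(1) j(2,1) i] dist_sym[OF vV[OF i] wV(1)] by simp
        next
          case 2
          then show ?thesis
            using companion_dist(1)[OF u D3 wV(2) w'(1) k(2,1), of "D - i"]
              dist_sym[OF vV[OF i] wV(2)] i by (simp add: u_def max.commute)
        next
          case 3
          then show ?thesis using geodesic_dist[OF v i] by auto
        qed
      qed
    qed
    then show False using extremal by simp
  qed
  moreover have "v 0 \<in> nbrs w" using w vV[of 0] by (simp add: nbrs_def)
  ultimately show ?thesis using W by blast
qed

text \<open>
  Neither end of a diametral geodesic is pendant, so each has a neighbour off the geodesic. These two
  neighbours are distinct because \<open>D > 2\<close>, and they are all the remaining vertices; the preceding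
  lemma, applied from both ends, determines their neighbours.
\<close>

theorem extremal_no_pendants:
  assumes deg: "\<And>x. x \<in> V \<Longrightarrow> 2 \<le> card (nbrs x)" and card: "card V = D + 3" and D: "4 \<le> D"
    and diam: "\<And>x y. x \<in> V \<Longrightarrow> y \<in> V \<Longrightarrow> d x y \<le> D"
    and ab: "a \<in> V" "b \<in> V" "d a b = D"
    and extremal: "total = extremal_total (card V) D"
  shows "\<exists>v w w'. geodesic D v \<and> V = insert w (insert w' (v ` {..D})) \<and> w \<noteq> w' \<and>
    w \<notin> v ` {..D} \<and> w' \<notin> v ` {..D} \<and> nbrs w = {v 0, v 1} \<and> nbrs w' = {v D, v (D - 1)}"
proof -
  obtain v where v: "geodesic D v" "v 0 = a" "v D = b" using geodesic_exists ab by blast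
  have vV: "\<And>i. i \<le> D \<Longrightarrow> v i \<in> V" using geodesic_in[OF v(1)] .
  have companion: "\<exists>w\<in>V - v ` {..D}. d w (v i) = 1" if i: "i = 0 \<or> i = D" for i
  proof (rule ccontr)
    assume no: "\<not> ?thesis"
    have iD: "i \<le> D" using i by auto
    have "nbrs (v i) \<subseteq> v ` {..D}"
    proof
      fix y assume "y \<in> nbrs (v i)"
      then have "y \<in> V" "d y (v i) = 1" using dist_sym[of y "v i"] vV[OF iD] by (auto simp: nbrs_def)
      then show "y \<in> v ` {..D}" using no by auto
    qed
    then have "nbrs (v i) \<subseteq> {v (if i = 0 then 1 else D - 1)}"
      using nbrs_on_geodesic[OF v(1) iD] i D by (auto split: if_splits)
    then have "card (nbrs (v i)) \<le> 1" using card_mono[of "{v (if i = 0 then 1 else D - 1)}"] by simp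
    then show False using deg[OF vV[OF iD]] by simp
  qed
  obtain w where w: "w \<in> V - v ` {..D}" "d w (v 0) = 1" using companion[of 0] by auto
  obtain w' where w': "w' \<in> V - v ` {..D}" "d w' (v D) = 1" using companion[of D] by auto
  have ne: "w \<noteq> w'"
  proof
    assume "w = w'"
    then have "D \<le> 2"
      using nbrs_of_companion[OF v(1) _ w(2), of D] w w' vV by (auto simp: nbrs_def)
    then show False using D by simp
  qed
  have "card (V - v ` {..D}) = 2" using card_off_geodesic[OF v(1)] card by simp
  then have "V - v ` {..D} = {w, w'}"
    using w w' ne finite_V card_subset_eq[of "V - v ` {..D}" "{w, w'}"] by auto
  then have V: "V = insert w (insert w' (v ` {..D}))" "w \<notin> v ` {..D}" "w' \<notin> v ` {..D}"
    using vV by auto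
  define u where "u i = v (D - i)" for i
  have u: "geodesic D u" using geodesic_rev[OF v(1)] by (simp add: u_def [abs_def])
  have im: "u ` {..D} = v ` {..D}"
    using image_reverse[of v D] by (simp add: u_def [abs_def])
  have "nbrs w = {v 0, v 1}"
    using extremal_end_triangle[OF v(1) D V w(2) w'(2) _ _ diam extremal] deg w w' by blast
  moreover have "nbrs w' = {u 0, u 1}"
  proof (rule extremal_end_triangle[OF u D])
    show "V = insert w' (insert w (u ` {..D}))" "w' \<notin> u ` {..D}" "w \<notin> u ` {..D}"
      using V im by auto
    show "d w' (u 0) = 1" "d w (u D) = 1" using w w' by (auto simp: u_def)
  qed (use deg w w' diam extremal in auto)
  then have "nbrs w' = {v D, v (D - 1)}" by (simp add: u_def)
  ultimately show ?thesis using v(1) V ne by blast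
qed

end

section \<open>Distances in graphs\<close>

locale connected_pair_graph = pair_graph G for G :: "'a pair_pre_digraph" +
  assumes connected_G: "connected G"
begin

abbreviation dst where "dst \<equiv> graph_dist (with_proj G)"

lemma ex_awalk: "u \<in> pverts G \<Longrightarrow> v \<in> pverts G \<Longrightarrow> \<exists>p. awalk u p v"
  using symmetric_connected_imp_strongly_connected[OF pair_sym_arcs connected_G]
  by (auto simp: strongly_connected_def reachable_awalk)

lemma dist_le_length: "awalk u p v \<Longrightarrow> dst u v \<le> length p"
  unfolding graph_dist_def by (intro Least_le) auto

lemma ex_shortest_awalk:
  assumes "u \<in> pverts G" "v \<in> pverts G"
  shows "\<exists>p. awalk u p v \<and> length p = dst u v"
proof -
  have "\<exists>n p. awalk u p v \<and> length p = n" using ex_awalk[OF assms] by blast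
  from LeastI_ex[OF this] show ?thesis unfolding graph_dist_def .
qed

lemma dist_eq_0: "u \<in> pverts G \<Longrightarrow> v \<in> pverts G \<Longrightarrow> dst u v = 0 \<longleftrightarrow> u = v"
  using ex_shortest_awalk[of u v] dist_le_length[of u "[]" v] by (auto simp: awalk_Nil_iff)

lemma dist_eq_1:
  assumes "u \<in> pverts G" "v \<in> pverts G"
  shows "dst u v = 1 \<longleftrightarrow> (u, v) \<in> parcs G"
proof
  assume "dst u v = 1"
  then obtain p where "awalk u p v" "length p = 1" using ex_shortest_awalk[OF assms] by auto
  then obtain e where "awalk u [e] v" by (metis One_nat_def length_0_conv length_Suc_conv)
  then show "(u, v) \<in> parcs G" by (auto simp: awalk_simps)
next
  assume uv: "(u, v) \<in> parcs G"
  then have "dst u v \<le> 1" using dist_le_length[of u "[(u, v)]" v] assms by (auto simp: awalk_simps)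
  moreover have "dst u v \<noteq> 0" using dist_eq_0[OF assms] no_loops'[OF uv] by simp
  ultimately show "dst u v = 1" by simp
qed

lemma dist_triangle:
  assumes "u \<in> pverts G" "v \<in> pverts G" "w \<in> pverts G"
  shows "dst u w \<le> dst u v + dst v w"
proof -
  obtain p q where "awalk u p v" "length p = dst u v" "awalk v q w" "length q = dst v w"
    using ex_shortest_awalk assms by meson
  then show ?thesis using dist_le_length[of u "p @ q" w] awalk_appendI by fastforce
qed

lemma dist_symmetric:
  assumes "u \<in> pverts G" "v \<in> pverts G" shows "dst u v = dst v u"
proof -
  have len: "length (rev_path p) = length p" for p :: "('a \<times> 'a) list" by (induct p) auto
  have "dst x y \<le> dst y x" if "x \<in> pverts G" "y \<in> pverts G" for x y
  proof -
    obtain p where "awalk y p x" "length p = dst y x" using ex_shortest_awalk \<open>x \<in> _\<close> \<open>y \<in> _\<close> by meson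
    then show ?thesis using dist_le_length[of x "rev_path p" y] by (simp add: len)
  qed
  then show ?thesis using assms by (simp add: le_antisym)
qed

sublocale graph_metric "pverts G" "graph_dist (with_proj G)"
proof
  show "finite (pverts G)" by (rule pair_finite_verts)
  show "pverts G \<noteq> {}" using connected_G by (auto simp: connected_def strongly_connected_def)
next
  fix x y m assume xy: "x \<in> pverts G" "y \<in> pverts G" and m: "dst x y = Suc m"
  obtain p where p: "awalk x p y" "length p = Suc m" using ex_shortest_awalk[OF xy] m by auto
  then obtain q e where qe: "p = q @ [e]" "length q = m" by (metis length_Suc_conv_rev)
  then have "awalk x q (fst e)" "e \<in> parcs G" "snd e = y"
    using p by (auto simp: awalk_simps)
  then have "(fst e, y) \<in> parcs G" "dst x (fst e) \<le> m" "fst e \<in> pverts G"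
    using dist_le_length qe by (auto simp: in_arcsD1)
  moreover then have "dst (fst e) y = 1" using dist_eq_1 xy by simp
  ultimately show "\<exists>z\<in>pverts G. dst x z = m \<and> dst z y = 1"
    using dist_triangle[OF xy(1) _ xy(2), of "fst e"] m by (intro bexI[of _ "fst e"]) auto
qed (use dist_eq_0 dist_symmetric dist_triangle in auto)

lemma total_eccentricity_eq: "total_eccentricity (with_proj G) = total"
proof -
  have "{graph_dist (with_proj G) v u | u. u \<in> pverts G} = graph_dist (with_proj G) v ` pverts G" for v
    by auto
  then show ?thesis by (simp add: total_eccentricity_def total_def eccentricity_def ecc_def)
qed

lemma card_nbrs: "x \<in> pverts G \<Longrightarrow> card (nbrs x) = out_degree (with_proj G) x"
proof -
  assume x: "x \<in> pverts G"
  have "out_arcs (with_proj G) x = Pair x ` nbrs x"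
    using x dist_eq_1[OF x] in_arcsD2 by (auto simp: out_arcs_def nbrs_def)
  then show ?thesis by (simp add: out_degree_def card_image inj_on_def)
qed

lemma pendant_verts_eq: "pendant_verts (with_proj G) = pendants"
  using card_nbrs by (auto simp: pendant_verts_def pendants_def)

lemma two_le_card_nbrs:
  assumes x: "x \<in> pverts G" and n: "2 \<le> card (pverts G)" and no: "pendants = {}"
  shows "2 \<le> card (nbrs x)"
proof -
  obtain y where y: "y \<in> pverts G" "y \<noteq> x" using ex_two_distinct[OF n] by metis
  then obtain m where "dst y x = Suc m" using dist_eq_0[OF y(1) x] by (cases "dst y x") auto
  then obtain z where "z \<in> pverts G" "dst z x = 1" using dist_step[OF y(1) x] by blast
  then have "z \<in> nbrs x" using dist_symmetric x by (auto simp: nbrs_def)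
  then have "card (nbrs x) \<noteq> 0" using finite_nbrs[of x] by auto
  moreover have "card (nbrs x) \<noteq> 1" using no x by (auto simp: pendants_def)
  ultimately show ?thesis by simp
qed

text \<open>
  The potential is given on the labels \<open>0, \<dots>, n - 1\<close> and pulled back along \<open>h\<close>. This gives the
  lower bound for every graph isomorphic to a labelled one, without comparing eccentricities along
  an isomorphism.
\<close>

lemma total_ge_labelled:
  assumes h: "bij_betw h (pverts G) {..<n}"
    and edges: "\<And>x y. (x, y) \<in> parcs G \<Longrightarrow> (h x, h y) \<in> E \<union> E\<inverse>"
    and lip: "\<And>i j. (i, j) \<in> E \<Longrightarrow> f i \<le> Suc (f j) \<and> f j \<le> Suc (f i)"
    and lab: "\<And>i. i \<le> D \<Longrightarrow> l i < n \<and> f (l i) = i"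
    and off: "\<And>i. i < n \<Longrightarrow> i \<notin> l ` {..D} \<Longrightarrow> f i = 0 \<or> f i = D"
  shows "extremal_total n D \<le> total"
proof -
  define g where "g = inv_into (pverts G) h"
  have hg: "h (g i) = i" "g i \<in> pverts G" if "i < n" for i
    using h that by (auto simp: g_def bij_betw_def f_inv_into_f inv_into_into)
  have gh: "g (h x) = x" if "x \<in> pverts G" for x
    using h that by (simp add: g_def bij_betw_inv_into_left)
  have hn: "h x < n" if "x \<in> pverts G" for x using h that by (auto simp: bij_betw_def)
  have "card (pverts G) = n" using bij_betw_same_card[OF h] by simp
  moreover have "extremal_total (card (pverts G)) D \<le> total"
  proof (rule total_ge_potential[of "f \<circ> h" D "g \<circ> l"])
    fix x y assume "x \<in> pverts G" "y \<in> pverts G" "dst x y = 1"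
    then show "(f \<circ> h) y \<le> Suc ((f \<circ> h) x)"
      using edges[of x y] lip dist_eq_1 by auto
  next
    show "(g \<circ> l) i \<in> pverts G \<and> (f \<circ> h) ((g \<circ> l) i) = i" if "i \<le> D" for i
      using lab[OF that] hg by auto
  next
    fix x assume x: "x \<in> pverts G - (g \<circ> l) ` {..D}"
    then have "h x \<notin> l ` {..D}" using gh[of x] by (fastforce simp: image_iff)
    then show "(f \<circ> h) x = 0 \<or> (f \<circ> h) x = D" using off hn x by auto
  qed
  ultimately show ?thesis by simp
qed

end

section \<open>Isomorphisms with labelled graphs\<close>

lemma digraph_iso_graph_onD:
  assumes "digraph_iso (with_proj G) (with_proj (graph_on n E))"
  shows "\<exists>h. bij_betw h (pverts G) {..<n} \<and> (\<forall>x y. (x, y) \<in> parcs G \<longrightarrow> (h x, h y) \<in> E \<union> E\<inverse>)"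
proof -
  from assms obtain f where f: "pre_digraph.digraph_isomorphism (with_proj G) f"
    and H: "with_proj (graph_on n E) = app_iso f (with_proj G)"
    unfolding digraph_iso_def by blast
  have v: "{..<n} = iso_verts f ` pverts G" using arg_cong[OF H, of verts] by (simp add: graph_on_def)
  have a: "E \<union> E\<inverse> = iso_arcs f ` parcs G" using arg_cong[OF H, of arcs] by (simp add: graph_on_def)
  have ht: "fst = iso_tail f" "snd = iso_head f"
    using arg_cong[OF H, of tail] arg_cong[OF H, of head] by simp_all
  have inj: "inj_on (iso_verts f) (pverts G)"
    and arc: "\<forall>e\<in>parcs G. iso_verts f (fst e) = fst (iso_arcs f e) \<and> iso_verts f (snd e) = snd (iso_arcs f e)"
    using f unfolding pre_digraph.digraph_isomorphism_def ht [symmetric] by simp_all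
  have "(iso_verts f x, iso_verts f y) \<in> E \<union> E\<inverse>" if "(x, y) \<in> parcs G" for x y
  proof -
    have "(iso_verts f x, iso_verts f y) = iso_arcs f (x, y)"
      using bspec[OF arc that] by (simp add: prod_eq_iff)
    then show ?thesis using that unfolding a by simp
  qed
  then show ?thesis using inj v by (auto simp: bij_betw_def)
qed

lemma digraph_iso_graph_onI:
  assumes G: "pair_graph G" and g: "bij_betw g {..<n} (pverts G)" and E: "E \<subseteq> {..<n} \<times> {..<n}"
    and edges: "\<And>i j. i < n \<Longrightarrow> j < n \<Longrightarrow> (g i, g j) \<in> parcs G \<longleftrightarrow> (i, j) \<in> E \<union> E\<inverse>"
  shows "digraph_iso (with_proj G) (with_proj (graph_on n E))"
proof -
  interpret pair_graph G by fact
  define h where "h = inv_into {..<n} g"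
  have h: "bij_betw h (pverts G) {..<n}" unfolding h_def using g by (rule bij_betw_inv_into)
  have hg: "h (g i) = i" if "i < n" for i using g that by (simp add: h_def bij_betw_inv_into_left)
  have gh: "g (h x) = x" if "x \<in> pverts G" for x
    using g that by (simp add: h_def bij_betw_inv_into_right)
  have hn: "h x < n" if "x \<in> pverts G" for x using h that by (auto simp: bij_betw_def)
  have gV: "g i \<in> pverts G" if "i < n" for i using g that by (auto simp: bij_betw_def)
  have arcs: "map_prod h h ` parcs G = E \<union> E\<inverse>"
  proof
    show "map_prod h h ` parcs G \<subseteq> E \<union> E\<inverse>"
    proof (safe, goal_cases)
      case (1 _ _ x y)
      then have V: "x \<in> pverts G" "y \<in> pverts G" by (auto simp: in_arcsD1 in_arcsD2)
      show ?case using 1 edges[OF hn[OF V(1)] hn[OF V(2)]] gh V by simp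
    qed
    show "E \<union> E\<inverse> \<subseteq> map_prod h h ` parcs G"
    proof
      fix e assume e: "e \<in> E \<union> E\<inverse>"
      then have lt: "fst e < n" "snd e < n" using E by auto
      moreover have "(fst e, snd e) \<in> E \<union> E\<inverse>" using e by simp
      ultimately have "(g (fst e), g (snd e)) \<in> parcs G" using edges by blast
      then show "e \<in> map_prod h h ` parcs G" using lt hg by (force simp: image_iff prod_eq_iff)
    qed
  qed
  have injh: "inj_on h (pverts G)" using h by (simp add: bij_betw_def)
  have "inj_on (map_prod h h) (parcs G)"
    by (rule inj_onI)
      (use inj_onD[OF injh] in_arcsD1 in_arcsD2 in \<open>auto simp: map_prod_def split: prod.splits\<close>)
  then show ?thesis
    unfolding digraph_iso_def
    by (intro exI[of _ "\<lparr>iso_verts = h, iso_arcs = map_prod h h, iso_head = snd, iso_tail = fst\<rparr>"])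
      (use arcs injh h wf_digraph in \<open>auto simp: pre_digraph.digraph_isomorphism_def app_iso_def
        with_proj_def graph_on_def bij_betw_def\<close>)
qed

text \<open>
  Following earlier neighbours leads from every vertex to 0.
\<close>

lemma connected_graph_on:
  assumes E: "E \<subseteq> {..<n} \<times> {..<n}" and loopfree: "\<And>i. (i, i) \<notin> E" and n: "0 < n"
    and parent: "\<And>j. 0 < j \<Longrightarrow> j < n \<Longrightarrow> \<exists>i<j. (i, j) \<in> E"
  shows "connected_pair_graph (graph_on n E)"
proof -
  let ?G = "graph_on n E"
  have "finite E" using E finite_subset by blast
  interpret pair_graph ?G
    using E loopfree \<open>finite E\<close>
    by unfold_locales (auto simp: graph_on_def symmetric_def sym_def)
  have "0 \<rightarrow>\<^sup>*\<^bsub>with_proj ?G\<^esub> j" if "j < n" for j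
    using that
  proof (induction j rule: less_induct)
    case (less j)
    show ?case
    proof (cases "j = 0")
      case True
      have "0 \<in> pverts ?G" using n by (simp add: graph_on_def)
      then have "awalk 0 [] 0" using awalk_Nil_iff by blast
      then show ?thesis using True reachable_awalkI by blast
    next
      case False
      then obtain i where i: "i < j" "(i, j) \<in> E" using parent less.prems by blast
      then have "0 \<rightarrow>\<^sup>*\<^bsub>with_proj ?G\<^esub> i" using less by simp
      moreover have "(i, j) \<in> parcs ?G" using i by (simp add: graph_on_def)
      ultimately show ?thesis by (rule reachable_adj_trans)
    qed
  qed
  then have "u \<rightarrow>\<^sup>*\<^bsub>with_proj ?G\<^esub> v" if "u < n" "v < n" for u v
    using reachable_trans[OF symmetric_reachable'[of 0 u], of v] that by simp
  then have "connected ?G"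
    using n by (intro connectedI reachable_mk_symmetricI) (auto simp: graph_on_def)
  then show ?thesis by unfold_locales
qed

section \<open>The named graphs\<close>

lemma path_edges_iff: "(i, j) \<in> path_edges a d \<longleftrightarrow> a \<le> i \<and> j = Suc i \<and> j < a + d"
proof
  assume *: "a \<le> i \<and> j = Suc i \<and> j < a + d"
  then have "(i, j) = (a + (i - a), a + (i - a) + 1) \<and> i - a + 1 < d" by auto
  then show "(i, j) \<in> path_edges a d" unfolding path_edges_def by blast
qed (auto simp: path_edges_def)

lemma T_graph_edge_iff:
  "(i, j) \<in> path_edges 0 d \<union> {(0, j) | j. d \<le> j \<and> j < d + l} \<union> {(d - 1, j) | j. d + l \<le> j \<and> j < d + l + m} \<longleftrightarrow>
    j = Suc i \<and> j < d \<or> i = 0 \<and> d \<le> j \<and> j < d + l \<or> i = d - 1 \<and> d + l \<le> j \<and> j < d + l + m"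
  by (auto simp: path_edges_iff)

lemma T_graph_connected:
  assumes "3 \<le> d"
  shows "connected_pair_graph (T_graph l m d)"
  unfolding T_graph_def
proof (rule connected_graph_on)
  let ?E = "path_edges 0 d \<union> {(0, j) | j. d \<le> j \<and> j < d + l} \<union> {(d - 1, j) | j. d + l \<le> j \<and> j < d + l + m}"
  show "?E \<subseteq> {..<l + m + d} \<times> {..<l + m + d}" using assms by (auto simp: path_edges_def)
  show "(i, i) \<notin> ?E" for i unfolding T_graph_edge_iff using assms by auto
  show "0 < l + m + d" using assms by simp
  show "\<exists>i<j. (i, j) \<in> ?E" if "0 < j" "j < l + m + d" for j
    unfolding T_graph_edge_iff using that assms
    by (intro exI[of _ "if j < d then j - 1 else if j < d + l then 0 else d - 1"]) auto
qed

lemma T_graph_pendants: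
  assumes "3 \<le> d" "1 \<le> l" "1 \<le> m"
  shows "pendant_verts (with_proj (T_graph l m d)) = {d..<l + m + d}"
proof -
  interpret connected_pair_graph "T_graph l m d" by (rule T_graph_connected) fact
  have V: "i \<in> pverts (T_graph l m d) \<longleftrightarrow> i < l + m + d" for i
    by (simp add: T_graph_def graph_on_def)
  have arc: "(i, j) \<in> parcs (T_graph l m d) \<longleftrightarrow>
      j = Suc i \<and> j < d \<or> i = 0 \<and> d \<le> j \<and> j < d + l \<or> i = d - 1 \<and> d + l \<le> j \<and> j < d + l + m \<or>
      i = Suc j \<and> i < d \<or> j = 0 \<and> d \<le> i \<and> i < d + l \<or> j = d - 1 \<and> d + l \<le> i \<and> i < d + l + m" for i j
    unfolding T_graph_def graph_on_def pair_pre_digraph.simps Un_iff[of _ _ "_\<inverse>"] converse_iff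
      T_graph_edge_iff by blast
  have nb: "nbrs i = {j. j < l + m + d \<and> (i, j) \<in> parcs (T_graph l m d)}" if "i < l + m + d" for i
    using dist_eq_1[of i] that by (auto simp: nbrs_def V)
  have "card (nbrs i) = 1 \<longleftrightarrow> d \<le> i" if i: "i < l + m + d" for i
  proof (cases "d \<le> i")
    case True
    then have "nbrs i = {if i < d + l then 0 else d - 1}"
      using i assms by (auto simp: nb[OF i] arc)
    then show ?thesis using True by simp
  next
    case False
    define p q where "p = (if i = 0 then d else i - 1)" and "q = (if i = d - 1 then d + l else i + 1)"
    have "{p, q} \<subseteq> nbrs i" unfolding nb[OF i] using False assms by (auto simp: arc p_def q_def)
    moreover have "p \<noteq> q" using False assms by (auto simp: p_def q_def)
    ultimately have "2 \<le> card (nbrs i)" using card_mono[OF finite_nbrs, of "{p, q}" i] by simp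
    then show ?thesis using False by simp
  qed
  then show ?thesis by (auto simp: pendant_verts_eq pendants_def V)
qed

text \<open>
  The potential is the position along the diametral path that starts at one of the \<open>l\<close> leaves and
  ends at one of the \<open>m\<close> leaves.
\<close>

lemma T_graph_total_ge:
  assumes "3 \<le> d" "1 \<le> l" "1 \<le> m"
  shows "extremal_total (l + m + d) (d + 1) \<le> total_eccentricity (with_proj (T_graph l m d))"
proof -
  interpret connected_pair_graph "T_graph l m d" by (rule T_graph_connected) fact
  let ?E = "path_edges 0 d \<union> {(0, j) | j. d \<le> j \<and> j < d + l} \<union> {(d - 1, j) | j. d + l \<le> j \<and> j < d + l + m}"
  define f where "f j = (if j < d then j + 1 else if j < d + l then 0 else d + 1)" for j
  \<comment> \<open>the vertex at position \<open>i\<close> of that path\<close>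
  define lab where "lab i = (if i = 0 then d else if i = d + 1 then d + l else i - 1)" for i
  show ?thesis unfolding total_eccentricity_eq
  proof (rule total_ge_labelled[of id "l + m + d" ?E f "d + 1" lab])
    show "bij_betw id (pverts (T_graph l m d)) {..<l + m + d}"
      by (simp add: T_graph_def graph_on_def)
    show "(id x, id y) \<in> ?E \<union> ?E\<inverse>" if "(x, y) \<in> parcs (T_graph l m d)" for x y
      using that by (simp add: T_graph_def graph_on_def)
    show "f i \<le> Suc (f j) \<and> f j \<le> Suc (f i)" if "(i, j) \<in> ?E" for i j
      using that unfolding T_graph_edge_iff using assms by (auto simp: f_def)
    show "lab i < l + m + d \<and> f (lab i) = i" if "i \<le> d + 1" for i
      using that assms by (auto simp: f_def lab_def)
    show "f i = 0 \<or> f i = d + 1" if "i < l + m + d" "i \<notin> lab ` {..d + 1}" for i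
    proof (cases "i < d")
      case True
      then have "i = lab (i + 1)" by (simp add: lab_def)
      then show ?thesis using that True by (metis atMost_iff image_eqI Suc_eq_plus1 Suc_leI less_SucI less_imp_le_nat)
    qed (auto simp: f_def)
  qed
qed

lemma cycle_edges_3: "cycle_edges a 3 = {(a, a + 1), (a + 1, a + 2), (a + 2, a)}"
proof -
  have "cycle_edges a 3 = (\<lambda>i. (a + i, a + (i + 1) mod 3)) ` {..<3}"
    by (auto simp: cycle_edges_def)
  also have "{..<3} = {0, 1, 2::nat}" by auto
  finally show ?thesis by simp
qed

lemma U_graph_3_edge_iff:
  assumes "4 \<le> n"
  shows "(i, j) \<in> cycle_edges 0 3 \<union> path_edges 3 (n - 3) \<union> {(0, 3)} \<longleftrightarrow>
    (i, j) \<in> {(0, 1), (1, 2), (2, 0), (0, 3)} \<or> 3 \<le> i \<and> j = Suc i \<and> j < n"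
proof -
  have path: "(i, j) \<in> path_edges 3 (n - 3) \<longleftrightarrow> 3 \<le> i \<and> j = Suc i \<and> j < n"
    unfolding path_edges_iff using assms by simp
  show ?thesis
    unfolding Un_iff cycle_edges_3 path by (simp only: insert_iff empty_iff add_0) blast
qed

lemma C_graph_3_3_edge_iff:
  assumes "7 \<le> n"
  shows "(i, j) \<in> cycle_edges 0 3 \<union> path_edges (3 - 1) (n + 2 - (3 + 3)) \<union> cycle_edges (n - 3) 3 \<longleftrightarrow>
    j = Suc i \<and> j < n \<or> (i, j) = (2, 0) \<or> (i, j) = (n - 1, n - 3)"
proof -
  have path: "(i, j) \<in> path_edges (3 - 1) (n + 2 - (3 + 3)) \<longleftrightarrow> 2 \<le> i \<and> j = Suc i \<and> j < n - 2"
  proof -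
    have "3 - 1 + (n + 2 - (3 + 3)) = n - 2" using assms by simp
    then show ?thesis unfolding path_edges_iff by simp
  qed
  have path': "j = Suc i \<and> j < n \<longleftrightarrow> i = 0 \<and> j = 0 + 1 \<or> i = 0 + 1 \<and> j = 0 + 2 \<or>
      2 \<le> i \<and> j = Suc i \<and> j < n - 2 \<or> i = n - 3 \<and> j = n - 3 + 1 \<or> i = n - 3 + 1 \<and> j = n - 3 + 2"
  proof (cases "j = Suc i")
    case True
    have "Suc i < n \<longleftrightarrow> i = 0 \<or> i = 1 \<or> 2 \<le> i \<and> Suc i < n - 2 \<or> i = n - 3 \<or> i = n - 3 + 1"
      using assms by arith
    then show ?thesis using True by auto
  next
    case False
    then show ?thesis by auto
  qed
  have "n - 3 + 2 = n - 1" using assms by simp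
  then show ?thesis
    unfolding Un_iff cycle_edges_3 path path' insert_iff empty_iff prod.inject
    by (simp only: add_0) blast
qed

context connected_pair_graph
begin

text \<open>
  A diametral path of \<open>U\<^sub>n\<^sub>,\<^sub>3\<close> is \<open>1, 0, 3, \<dots>, n - 1\<close>; the vertex 2 gets the same potential as its
  twin 1.
\<close>

lemma total_ge_U_graph:
  assumes n: "4 \<le> n" and iso: "digraph_iso (with_proj G) (with_proj (U_graph n 3))"
  shows "extremal_total n (n - 2) \<le> total"
proof -
  let ?E = "cycle_edges 0 3 \<union> path_edges 3 (n - 3) \<union> {(0, 3)}"
  obtain h where h: "bij_betw h (pverts G) {..<n}"
    "\<And>x y. (x, y) \<in> parcs G \<Longrightarrow> (h x, h y) \<in> ?E \<union> ?E\<inverse>"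
    using digraph_iso_graph_onD[OF iso[unfolded U_graph_def]] by blast
  define f where "f j = (if j = 0 then 1 else if j \<le> 2 then 0 else j - 1)" for j :: nat
  define lab where "lab i = (if i = 0 then 1 else if i = 1 then 0 else i + 1)" for i :: nat
  show ?thesis
  proof (rule total_ge_labelled[OF h, of f _ lab])
    show "f i \<le> Suc (f j) \<and> f j \<le> Suc (f i)" if "(i, j) \<in> ?E" for i j
      using that unfolding U_graph_3_edge_iff[OF n] by (auto simp: f_def)
    show "lab i < n \<and> f (lab i) = i" if "i \<le> n - 2" for i
      using that n by (auto simp: f_def lab_def)
    show "f i = 0 \<or> f i = n - 2" if "i < n" "i \<notin> lab ` {..n - 2}" for i
    proof (rule ccontr)
      assume "\<not> ?thesis"
      then have "i = lab (f i)" "f i \<le> n - 2" using that(1) n by (auto simp: f_def lab_def)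
      then show False using that(2) by blast
    qed
  qed
qed

text \<open>
  A diametral path of \<open>C\<^sub>3\<^sub>,\<^sub>3\<close> is \<open>1, 2, \<dots>, n - 2\<close>; the two other vertices get the potential of
  the end next to them.
\<close>

lemma total_ge_C_graph:
  assumes n: "7 \<le> n" and iso: "digraph_iso (with_proj G) (with_proj (C_graph 3 3 n))"
  shows "extremal_total n (n - 3) \<le> total"
proof -
  let ?E = "cycle_edges 0 3 \<union> path_edges (3 - 1) (n + 2 - (3 + 3)) \<union> cycle_edges (n - 3) 3"
  obtain h where h: "bij_betw h (pverts G) {..<n}"
    "\<And>x y. (x, y) \<in> parcs G \<Longrightarrow> (h x, h y) \<in> ?E \<union> ?E\<inverse>"
    using digraph_iso_graph_onD[OF iso[unfolded C_graph_def]] by blast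
  define f where "f j = (if j = n - 1 then n - 3 else j - 1)" for j :: nat
  show ?thesis
  proof (rule total_ge_labelled[OF h, of f _ Suc])
    show "f i \<le> Suc (f j) \<and> f j \<le> Suc (f i)" if "(i, j) \<in> ?E" for i j
      using that n unfolding C_graph_3_3_edge_iff[OF n] by (auto simp: f_def)
    show "Suc i < n \<and> f (Suc i) = i" if "i \<le> n - 3" for i
      using that n by (auto simp: f_def)
    show "f i = 0 \<or> f i = n - 3" if "i < n" "i \<notin> Suc ` {..n - 3}" for i
    proof (rule ccontr)
      assume "\<not> ?thesis"
      then have "i = Suc (f i)" "f i \<le> n - 3" using that(1) n by (auto simp: f_def split: if_splits)
      then show False using that(2) by blast
    qed
  qed
qed

lemma iso_U_graph:
  assumes n: "4 \<le> n" and v: "geodesic (n - 2) v" and V: "pverts G = insert w (v ` {..n - 2})"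
    and w: "w \<notin> v ` {..n - 2}" "nbrs w = {v 0, v 1}"
  shows "digraph_iso (with_proj G) (with_proj (U_graph n 3))"
proof -
  let ?E = "cycle_edges 0 3 \<union> path_edges 3 (n - 3) \<union> {(0, 3)}"
  \<comment> \<open>vertex 0 carries the path, so it is \<open>v\<^sub>1\<close>; vertex 1 is \<open>v\<^sub>0\<close> and vertex 2 is \<open>w\<close>\<close>
  define ix where "ix i = (if i = 0 then 1 else if i = 1 then 0 else i - 1)" for i :: nat
  define g where "g i = (if i = 2 then w else v (ix i))" for i
  have ix: "ix i \<le> n - 2" if "i < n" for i using that n by (auto simp: ix_def)
  have V': "w \<in> pverts G" "\<And>i. i \<le> n - 2 \<Longrightarrow> v i \<in> pverts G" using V by auto
  have vw: "v (ix i) \<noteq> w" if "i < n" for i using w(1) ix[OF that] by auto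
  have arc_vv: "(v i, v j) \<in> parcs G \<longleftrightarrow> j = Suc i \<or> i = Suc j" if "i \<le> n - 2" "j \<le> n - 2" for i j
    using nbrs_on_geodesic[OF v that] dist_eq_1 V' that by (auto simp: nbrs_def)
  have arc_w: "(w, v j) \<in> parcs G \<longleftrightarrow> j \<le> 1" if "j \<le> n - 2" for j
  proof -
    have "(w, v j) \<in> parcs G \<longleftrightarrow> v j \<in> {v 0, v 1}"
      unfolding w(2) [symmetric] using dist_eq_1 V' that by (auto simp: nbrs_def)
    also have "\<dots> \<longleftrightarrow> j \<le> 1"
      using geodesic_eq_iff[OF v that, of 0] geodesic_eq_iff[OF v that, of 1] n by auto
    finally show ?thesis .
  qed
  have arc_w': "(v j, w) \<in> parcs G \<longleftrightarrow> j \<le> 1" if "j \<le> n - 2" for j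
    using arc_w[OF that] arcs_symmetric by blast
  show ?thesis unfolding U_graph_def
  proof (rule digraph_iso_graph_onI[OF _ _ _, of _ g])
    show "pair_graph G" by (rule pair_graph_axioms)
    show "?E \<subseteq> {..<n} \<times> {..<n}"
    proof (rule subrelI)
      fix i j assume "(i, j) \<in> ?E"
      then show "(i, j) \<in> {..<n} \<times> {..<n}" unfolding U_graph_3_edge_iff[OF n] using n by auto
    qed
    show "bij_betw g {..<n} (pverts G)"
    proof -
      have "v i \<in> g ` {..<n}" if "i \<le> n - 2" for i
        using that n
        by (intro image_eqI[of _ _ "if i = 0 then 1 else if i = 1 then 0 else i + 1"])
          (auto simp: g_def ix_def)
      moreover have "w \<in> g ` {..<n}" using n by (intro image_eqI[of _ _ 2]) (auto simp: g_def)
      moreover have "g i \<in> pverts G" if "i < n" for i using V' ix[OF that] by (simp add: g_def)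
      ultimately have surj: "g ` {..<n} = pverts G" using V by blast
      have "card (pverts G) = n" using card_geodesic[OF v] w(1) n unfolding V by simp
      then have "inj_on g {..<n}" using surj by (intro eq_card_imp_inj_on) auto
      then show ?thesis using surj by (rule bij_betw_imageI)
    qed
    fix i j assume ij: "i < n" "j < n"
    have rhs: "(i, j) \<in> ?E \<union> ?E\<inverse> \<longleftrightarrow>
        ((i, j) \<in> {(0, 1), (1, 2), (2, 0), (0, 3)} \<or> 3 \<le> i \<and> j = Suc i) \<or>
        ((j, i) \<in> {(0, 1), (1, 2), (2, 0), (0, 3)} \<or> 3 \<le> j \<and> i = Suc j)"
      unfolding Un_iff[of _ _ "_\<inverse>"] converse_iff U_graph_3_edge_iff[OF n] by (simp only: ij simp_thms)
    have "(g i, g j) \<in> parcs G \<longleftrightarrow>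
      (if i = 2 then j \<noteq> 2 \<and> ix j \<le> 1
       else if j = 2 then ix i \<le> 1 else ix j = Suc (ix i) \<or> ix i = Suc (ix j))"
      using arc_vv[OF ix ix, of i j] arc_w[OF ix, of j] arc_w'[OF ix, of i] no_loops'[of w w] ij
      by (auto simp: g_def)
    also have "\<dots> \<longleftrightarrow>
        ((i, j) \<in> {(0, 1), (1, 2), (2, 0), (0, 3)} \<or> 3 \<le> i \<and> j = Suc i) \<or>
        ((j, i) \<in> {(0, 1), (1, 2), (2, 0), (0, 3)} \<or> 3 \<le> j \<and> i = Suc j)"
    proof -
      consider "i = 0" | "i = 1" | "i = 2" | "3 \<le> i" by linarith
      then show ?thesis
        unfolding ix_def insert_iff empty_iff prod.inject by cases (simp, presburger)+
    qed
    also have "\<dots> \<longleftrightarrow> (i, j) \<in> ?E \<union> ?E\<inverse>" by (rule rhs [symmetric])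
    finally show "(g i, g j) \<in> parcs G \<longleftrightarrow> (i, j) \<in> ?E \<union> ?E\<inverse>" .
  qed
qed

lemma iso_C_graph:
  assumes n: "7 \<le> n" and v: "geodesic (n - 3) v" and V: "pverts G = insert w (insert w' (v ` {..n - 3}))"
    and w: "w \<noteq> w'" "w \<notin> v ` {..n - 3}" "w' \<notin> v ` {..n - 3}"
    and nb: "nbrs w = {v 0, v 1}" "nbrs w' = {v (n - 3), v (n - 3 - 1)}"
  shows "digraph_iso (with_proj G) (with_proj (C_graph 3 3 n))"
proof -
  let ?E = "cycle_edges 0 3 \<union> path_edges (3 - 1) (n + 2 - (3 + 3)) \<union> cycle_edges (n - 3) 3"
  \<comment> \<open>the labels \<open>1, \<dots>, n - 2\<close> run along the geodesic\<close>
  define g where "g i = (if i = 0 then w else if i = n - 1 then w' else v (i - 1))" for i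
  have V': "w \<in> pverts G" "w' \<in> pverts G" "\<And>i. i \<le> n - 3 \<Longrightarrow> v i \<in> pverts G" using V by auto
  have vw: "v i \<noteq> w" "v i \<noteq> w'" if "i \<le> n - 3" for i using w that by auto
  have arc_vv: "(v i, v j) \<in> parcs G \<longleftrightarrow> j = Suc i \<or> i = Suc j" if "i \<le> n - 3" "j \<le> n - 3" for i j
    using nbrs_on_geodesic[OF v that] dist_eq_1 V' that by (auto simp: nbrs_def)
  have arc_w: "(w, x) \<in> parcs G \<longleftrightarrow> x \<in> nbrs w" "(w', x) \<in> parcs G \<longleftrightarrow> x \<in> nbrs w'" for x
    using dist_eq_1 V' in_arcsD2 by (auto simp: nbrs_def)
  have arc_wv: "(w, v j) \<in> parcs G \<longleftrightarrow> j \<le> 1" "(w', v j) \<in> parcs G \<longleftrightarrow> n - 4 \<le> j"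
    if "j \<le> n - 3" for j
  proof -
    have "v j = v 0 \<longleftrightarrow> j = 0" "v j = v 1 \<longleftrightarrow> j = 1" "v j = v (n - 3) \<longleftrightarrow> j = n - 3"
      "v j = v (n - 3 - 1) \<longleftrightarrow> j = n - 3 - 1"
      using geodesic_eq_iff[OF v that] n by simp_all
    then have "v j \<in> nbrs w \<longleftrightarrow> j = 0 \<or> j = 1" "v j \<in> nbrs w' \<longleftrightarrow> j = n - 3 \<or> j = n - 3 - 1"
      unfolding nb by simp_all
    then show "(w, v j) \<in> parcs G \<longleftrightarrow> j \<le> 1" "(w', v j) \<in> parcs G \<longleftrightarrow> n - 4 \<le> j"
      unfolding arc_w using that n by auto
  qed
  have arc_vw: "(v j, w) \<in> parcs G \<longleftrightarrow> j \<le> 1" "(v j, w') \<in> parcs G \<longleftrightarrow> n - 4 \<le> j"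
    if "j \<le> n - 3" for j
    using arc_wv[OF that] arcs_symmetric by blast+
  have arc_ww: "(w, w') \<notin> parcs G" "(w', w) \<notin> parcs G" "(w, w) \<notin> parcs G" "(w', w') \<notin> parcs G"
    unfolding arc_w nb using w n vw[of 0] vw[of 1] vw[of "n - 3"] vw[of "n - 3 - 1"] by auto
  show ?thesis unfolding C_graph_def
  proof (rule digraph_iso_graph_onI[OF _ _ _, of _ g])
    show "pair_graph G" by (rule pair_graph_axioms)
    show "?E \<subseteq> {..<n} \<times> {..<n}"
    proof (rule subrelI)
      fix i j assume "(i, j) \<in> ?E"
      then show "(i, j) \<in> {..<n} \<times> {..<n}" unfolding C_graph_3_3_edge_iff[OF n] using n by auto
    qed
    show "bij_betw g {..<n} (pverts G)"
    proof -
      have "v i \<in> g ` {..<n}" if "i \<le> n - 3" for i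
        using that n by (intro image_eqI[of _ _ "i + 1"]) (auto simp: g_def)
      moreover have "w \<in> g ` {..<n}" using n by (intro image_eqI[of _ _ 0]) (auto simp: g_def)
      moreover have "w' \<in> g ` {..<n}" using n by (intro image_eqI[of _ _ "n - 1"]) (auto simp: g_def)
      moreover have "g i \<in> pverts G" if "i < n" for i using that n V' by (simp add: g_def)
      ultimately have surj: "g ` {..<n} = pverts G" using V by blast
      have "card (pverts G) = n" using card_geodesic[OF v] w n unfolding V by simp
      then have "inj_on g {..<n}" using surj by (intro eq_card_imp_inj_on) auto
      then show ?thesis using surj by (rule bij_betw_imageI)
    qed
    fix i j assume ij: "i < n" "j < n"
    have rhs: "(i, j) \<in> ?E \<union> ?E\<inverse> \<longleftrightarrow>
        (j = Suc i \<or> i = 2 \<and> j = 0 \<or> i = n - 1 \<and> j = n - 3) \<or>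
        (i = Suc j \<or> j = 2 \<and> i = 0 \<or> j = n - 1 \<and> i = n - 3)"
      unfolding Un_iff[of _ _ "_\<inverse>"] converse_iff C_graph_3_3_edge_iff[OF n] prod.inject
      by (simp only: ij simp_thms)
    have le: "k - 1 \<le> n - 3" if "k < n" "k \<noteq> n - 1" for k using that n by simp
    have "(g i, g j) \<in> parcs G \<longleftrightarrow>
      (if i = 0 then j \<noteq> 0 \<and> j \<noteq> n - 1 \<and> j - 1 \<le> 1
       else if i = n - 1 then j \<noteq> 0 \<and> j \<noteq> n - 1 \<and> n - 4 \<le> j - 1
       else if j = 0 then i - 1 \<le> 1 else if j = n - 1 then n - 4 \<le> i - 1
       else j - 1 = Suc (i - 1) \<or> i - 1 = Suc (j - 1))"
      using arc_vv[OF le le, of i j] arc_wv[OF le, of j] arc_vw[OF le, of i] arc_ww ij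
      by (simp add: g_def)
    also have "\<dots> \<longleftrightarrow>
        (j = Suc i \<or> i = 2 \<and> j = 0 \<or> i = n - 1 \<and> j = n - 3) \<or>
        (i = Suc j \<or> j = 2 \<and> i = 0 \<or> j = n - 1 \<and> i = n - 3)"
    proof -
      consider "i = 0" | "0 < i" "i = n - 1" | "0 < i" "i < n - 1" using ij by linarith
      then show ?thesis
      proof cases
        case 1
        then show ?thesis using ij n by (simp, presburger)
      next
        case 2
        then show ?thesis using ij n by (simp, presburger)
      next
        case i: 3
        consider "j = 0" | "0 < j" "j = n - 1" | "0 < j" "j < n - 1" using ij by linarith
        then show ?thesis
        proof cases
          case 1
          then show ?thesis using i ij n by (simp, presburger)
        next
          case 2
          then show ?thesis using i ij n by (simp, presburger)
        next
          case 3
          then show ?thesis using i ij n by (simp, presburger)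
        qed
      qed
    qed
    also have "\<dots> \<longleftrightarrow> (i, j) \<in> ?E \<union> ?E\<inverse>" by (rule rhs [symmetric])
    finally show "(g i, g j) \<in> parcs G \<longleftrightarrow> (i, j) \<in> ?E \<union> ?E\<inverse>" .
  qed
qed

end

section \<open>The bounds for connected graphs with given pendant vertices\<close>

lemma total_eccentricity_le_many_pendants:
  assumes "H \<in> connected_graphs n k" "2 \<le> k"
  shows "total_eccentricity (with_proj H) \<le> extremal_total n (n + 1 - k)"
proof -
  have H: "pair_graph H" "connected (with_proj H)" "card (pverts H) = n"
    "card (pendant_verts (with_proj H)) = k"
    using assms by (auto simp: connected_graphs_def)
  interpret pair_graph H by (rule H)
  interpret connected_pair_graph H by unfold_locales (rule H)
  show ?thesis
    using total_le_many_pendants[of k] H assms(2)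
    by (simp add: total_eccentricity_eq pendant_verts_eq)
qed

theorem theorem3p7:
  fixes n k :: nat and G :: "'a pair_pre_digraph"
  assumes "k + 3 \<le> n"
    and "G \<in> connected_graphs n k"
  shows "(2 \<le> k \<longrightarrow>
      int (total_eccentricity G)
        \<le> \<lfloor>(3 * real n ^ 2 - real k ^ 2 - 2 * real n * real k + 2 * (real n + real k)) / 4\<rfloor> \<and>
      (\<forall>l. 1 \<le> l \<and> l \<le> k - 1 \<longrightarrow>
        T_graph l (k - l) (n - k) \<in> connected_graphs n k \<and>
        int (total_eccentricity (T_graph l (k - l) (n - k)))
          = \<lfloor>(3 * real n ^ 2 - real k ^ 2 - 2 * real n * real k + 2 * (real n + real k)) / 4\<rfloor>)) \<and>
    (k = 1 \<longrightarrow>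
      int (total_eccentricity G) \<le> \<lfloor>(3 * real n ^ 2 - 4 * real n - 3) / 4\<rfloor> \<and>
      (int (total_eccentricity G) = \<lfloor>(3 * real n ^ 2 - 4 * real n - 3) / 4\<rfloor>
        \<longleftrightarrow> digraph_iso G (U_graph n 3))) \<and>
    (7 \<le> n \<and> k = 0 \<longrightarrow>
      int (total_eccentricity G) \<le> \<lfloor>(3 * real n ^ 2 - 6 * real n - 8) / 4\<rfloor> \<and>
      (int (total_eccentricity G) = \<lfloor>(3 * real n ^ 2 - 6 * real n - 8) / 4\<rfloor>
        \<longleftrightarrow> digraph_iso G (C_graph 3 3 n)))"
proof -
  have G: "pair_graph G" "connected (with_proj G)" and card_V: "card (pverts G) = n"
    and card_p: "card (pendant_verts (with_proj G)) = k"
    using assms(2) by (auto simp: connected_graphs_def)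
  interpret pair_graph G by (rule G)
  interpret connected_pair_graph G by unfold_locales (rule G)
  have pend: "card pendants = k" using card_p by (simp add: pendant_verts_eq)
  have part1: "int (total_eccentricity (with_proj G))
        \<le> \<lfloor>(3 * real n ^ 2 - real k ^ 2 - 2 * real n * real k + 2 * (real n + real k)) / 4\<rfloor> \<and>
      (\<forall>l. 1 \<le> l \<and> l \<le> k - 1 \<longrightarrow>
        T_graph l (k - l) (n - k) \<in> connected_graphs n k \<and>
        int (total_eccentricity (with_proj (T_graph l (k - l) (n - k))))
          = \<lfloor>(3 * real n ^ 2 - real k ^ 2 - 2 * real n * real k + 2 * (real n + real k)) / 4\<rfloor>)"
    if k: "2 \<le> k"
  proof -
    have val: "int (extremal_total n (n + 1 - k)) =
        \<lfloor>(3 * real n ^ 2 - real k ^ 2 - 2 * real n * real k + 2 * (real n + real k)) / 4\<rfloor>"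
      using k assms(1) by (intro extremal_total_eq_floor) auto
    have "T_graph l (k - l) (n - k) \<in> connected_graphs n k \<and>
        total_eccentricity (with_proj (T_graph l (k - l) (n - k))) = extremal_total n (n + 1 - k)"
      if l: "1 \<le> l" "l \<le> k - 1" for l
    proof -
      have d: "3 \<le> n - k" "1 \<le> k - l" "l + (k - l) + (n - k) = n" "n - k + 1 = n + 1 - k"
        using l k assms(1) by auto
      interpret T: connected_pair_graph "T_graph l (k - l) (n - k)"
        by (rule T_graph_connected) (rule d)
      have "card (pendant_verts (with_proj (T_graph l (k - l) (n - k)))) = k"
        using T_graph_pendants[OF d(1) l(1) d(2)] d(3) l by simp
      moreover have "card (pverts (T_graph l (k - l) (n - k))) = n"
        using d(3) by (simp add: T_graph_def graph_on_def)
      ultimately have mem: "T_graph l (k - l) (n - k) \<in> connected_graphs n k"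
        using T.pair_graph_axioms T.connected_G by (simp add: connected_graphs_def)
      moreover have "extremal_total n (n + 1 - k)
          \<le> total_eccentricity (with_proj (T_graph l (k - l) (n - k)))"
        using T_graph_total_ge[OF d(1) l(1) d(2)] unfolding d(3,4) .
      ultimately show ?thesis using total_eccentricity_le_many_pendants[OF mem k] by simp
    qed
    then show ?thesis using total_eccentricity_le_many_pendants[OF assms(2) k] val by (metis of_nat_le_iff)
  qed
  have part2: "int (total_eccentricity (with_proj G)) \<le> \<lfloor>(3 * real n ^ 2 - 4 * real n - 3) / 4\<rfloor> \<and>
      (int (total_eccentricity (with_proj G)) = \<lfloor>(3 * real n ^ 2 - 4 * real n - 3) / 4\<rfloor>
        \<longleftrightarrow> digraph_iso (with_proj G) (with_proj (U_graph n 3)))"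
    if k: "k = 1"
  proof -
    have n: "4 \<le> n" using assms(1) k by simp
    have val: "int (extremal_total n (n - 2)) = \<lfloor>(3 * real n ^ 2 - 4 * real n - 3) / 4\<rfloor>"
      using extremal_total_eq_floor[of 3 n] n by (simp add: algebra_simps)
    have le: "total \<le> extremal_total n (n - 2)"
      using total_one_pendant(1) pend k n card_V by simp
    have "digraph_iso (with_proj G) (with_proj (U_graph n 3))" if eq: "total = extremal_total n (n - 2)"
    proof -
      from total_one_pendant(2) obtain a b where
        diam: "\<And>x y. x \<in> pverts G \<Longrightarrow> y \<in> pverts G \<Longrightarrow> dst x y \<le> n - 2"
        and ab: "a \<in> pverts G" "b \<in> pverts G" "dst a b = n - 2"
        using pend k n card_V eq by auto
      have "card (pverts G) = n - 2 + 2" "2 \<le> n - 2" "total = extremal_total (card (pverts G)) (n - 2)"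
        using n card_V eq by auto
      from extremal_one_pendant[OF _ this(1,2) diam ab this(3)] obtain v w where
        "geodesic (n - 2) v" "pverts G = insert w (v ` {..n - 2})"
        "w \<notin> v ` {..n - 2}" "nbrs w = {v 0, v 1}"
        using pend k by blast
      then show ?thesis by (rule iso_U_graph[OF n])
    qed
    then show ?thesis
      using le total_ge_U_graph[OF n] unfolding val [symmetric] total_eccentricity_eq by fastforce
  qed
  have part3: "int (total_eccentricity (with_proj G)) \<le> \<lfloor>(3 * real n ^ 2 - 6 * real n - 8) / 4\<rfloor> \<and>
      (int (total_eccentricity (with_proj G)) = \<lfloor>(3 * real n ^ 2 - 6 * real n - 8) / 4\<rfloor>
        \<longleftrightarrow> digraph_iso (with_proj G) (with_proj (C_graph 3 3 n)))"
    if n: "7 \<le> n" and k: "k = 0"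
  proof -
    have val: "int (extremal_total n (n - 3)) = \<lfloor>(3 * real n ^ 2 - 6 * real n - 8) / 4\<rfloor>"
      using extremal_total_eq_floor[of 4 n] n by (simp add: algebra_simps)
    have "pendants = {}" using pend k finite_V by (simp add: pendants_def)
    then have deg: "\<And>x. x \<in> pverts G \<Longrightarrow> 2 \<le> card (nbrs x)"
      using two_le_card_nbrs card_V n by simp
    have le: "total \<le> extremal_total n (n - 3)"
      using total_no_pendants(1)[OF deg] n card_V by simp
    have "digraph_iso (with_proj G) (with_proj (C_graph 3 3 n))" if eq: "total = extremal_total n (n - 3)"
    proof -
      from total_no_pendants(2)[OF deg] obtain a b where
        diam: "\<And>x y. x \<in> pverts G \<Longrightarrow> y \<in> pverts G \<Longrightarrow> dst x y \<le> n - 3"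
        and ab: "a \<in> pverts G" "b \<in> pverts G" "dst a b = n - 3"
        using n card_V eq by auto
      have "card (pverts G) = n - 3 + 3" "4 \<le> n - 3" "total = extremal_total (card (pverts G)) (n - 3)"
        using n card_V eq by auto
      from extremal_no_pendants[OF deg this(1,2) diam ab this(3)] obtain v w w' where
        "geodesic (n - 3) v" "pverts G = insert w (insert w' (v ` {..n - 3}))" "w \<noteq> w'"
        "w \<notin> v ` {..n - 3}" "w' \<notin> v ` {..n - 3}"
        "nbrs w = {v 0, v 1}" "nbrs w' = {v (n - 3), v (n - 3 - 1)}"
        by blast
      then show ?thesis by (rule iso_C_graph[OF n])
    qed
    then show ?thesis
      using le total_ge_C_graph[OF n] unfolding val [symmetric] total_eccentricity_eq by fastforce
  qed
  show ?thesis using part1 part2 part3 by blast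
qed

end
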